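(* Let $n\geq 1$ and let $\mu,\lambda\in\Lambda_{odd}$ with $\mu=a\varepsilon+b\delta$ and $\mu'=(-a-2)\varepsilon+b\delta$. Then the numbers $N^n_n(\mu,\lambda)$ are as follows. If $a\geq 1$, then $N^n_n(\mu,\lambda)=1$ if one of the following holds: (i) $\lambda=\mu+m\varepsilon+n\delta$ for some $m\in M_n$ with $m>2(n-a-1)$; (ii) $\lambda=\mu'+m\varepsilon+(n-1)\delta$ for some $m\in M_{n-1}$ with $m<-2(n-a-2)$; (iii) $\lambda=\mu+m\varepsilon+(n-2)\delta$ for some $m\in M_{n-2}$ with $m>2(n-a-3)$; and $N^n_n(\mu,\lambda)=0$ otherwise. If $a\leq -1$, then $N^n_n(\mu,\lambda)=1$ if one of the following holds: (i) $\lambda=\mu+m\varepsilon+n\delta$ for some $m\in M_n$ with $m<1-a$; (ii) $\lambda=\mu'+m\varepsilon+(n-1)\delta$ for some $m\in M_{n-1}$ with $m>2(n+a)$; and $N^n_n(\mu,\lambda)=0$ otherwise.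
   Context: For $n\ge 0$, $M_n=\{2n,2n-4,\dots,-2n+4,-2n\}$ (so $M_0=\{0\}$), and $M_{-1}=\varnothing$. $\Lambda_{odd}=\{(2n+1)\varepsilon+(2k-n)\delta:n,k\in\mathbb{Z}\}\subset\mathbb{Z}\varepsilon\oplus\mathbb{Z}\delta$; the weight $a\varepsilon+b\delta$ is also written $(a,b)$. The algebra. Let $Q$ be the quiver with vertex set $\Lambda_{odd}$ and arrows (one for each vertex $(a,b)\in \Lambda_{odd}$ with $a$ in the indicated range): $f:(a,b)\to(a+2,b+1)$ for $a\ge 1$; $g:(a,b)\to(a-2,b+1)$ for $a\geq 3$; $p:(a,b)\to(-a-2,b)$ for $a\ge1$; $q:(-a-2,b)\to(a,b)$ for $a\geq 1$; $f':(-a-2,b)\to(-a-4,b+1)$ for $a\ge -1$; $g':(-a-2,b)\to(-a,b+1)$ for $a\ge 1$. Paths are composed right to left ($gf$ means first $f$, then $g$). $\mathcal{A}=\mathbb{C}Q/I$, where $I$ is the two-sided ideal generated, for each $(a,b)\in\Lambda_{odd}$ with $a\geq-1$, by the following relations between paths with source $(a,b)$ or $(-a-2,b)$ (monomials that are not paths in $Q$ are omitted): - $a\ge3$: $f^2=g^2=f'^2=g'^2=qp=0$, $fg+\frac{a-1}{a+3}gf=0$, $f'g'+\left(\frac{a-1}{a+3}\right)^2g'f'=0$, $f'p=(a+1)pf$, $qf'=(a+3)fq$, $g'p=(a+1)pg$, $qg'=(a-1)gq$; - $a=1$: $f^2=f'^2=qp=0$, $f'g'-\frac1{16}g'f'=0$,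 $f'p=2pf$, $qf'=4fq$; - $a=-1$: $f'^2=g'f'=0$. ($\mathcal{A}$ is the endomorphism algebra of the indecomposable projectives in the block $\mathcal{O}_{odd}$ of category $\mathcal{O}$ of $\mathfrak{pe}(2)$.) $\mathcal{A}$ is graded by path length, with $\mathcal{A}_0$ spanned by the idempotents $e_\lambda$, $\lambda\in\Lambda_{odd}$. The resolution. Modules are graded left $\mathcal{A}$-modules; $M\langle n\rangle_i=M_{i-n}$; $\mathcal{P}(\lambda)=\mathcal{A}e_\lambda$; $\mathbb{C}e_\lambda$ is the simple quotient of $\mathcal{P}(\lambda)$, in degree 0. An element of $M$ is homogeneous if it lies in $(e_\lambda M)_i$ for some $\lambda,i$. Fix $\mu$. Put $\mathcal{P}^\mu_0=\mathcal{P}(\mu)$ and let $\phi_0^\mu:\mathcal{P}_0^\mu\to\mathbb{C}e_\mu$ be the canonical surjection. Inductively for $n\ge1$ let $G^\mu_{n-1}$ be a minimal homogeneous generating set of $\ker\phi^\mu_{n-1}$; for $g\in G^\mu_{n-1}$ let $\lambda_g$ be the weight with $g\in e_{\lambda_g}\mathcal{P}^\mu_{n-1}$; put $\mathcal{P}^\mu_n=\bigoplus_{g\in G^\mu_{n-1}}\mathcal{P}(\lambda_g)\langle\deg g\rangle$ and let $\phi^\mu_n:\mathcal{P}_n^\mu\to\mathcal{P}_{n-1}^\mu$ send $e_{\lambda_g}\mapsto g$. The complex $\cdots\to(\mathcal{P}_2^\mu)^2\to(\mathcal{P}_1^\mu)^1\to\mathcal{P}_0^\mu\to\mathbb{C}e_\mu$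 is obtained by keeping in each $\mathcal{P}_n^\mu$ only the summands with $\deg g=n$: $(\mathcal{P}_n^\mu)^n=\bigoplus_{g\in G^\mu_{n-1},\,\deg g=n}\mathcal{P}(\lambda_g)\langle n\rangle$, with restricted maps. $N^n_n(\mu,\lambda)$ is the multiplicity of $\mathcal{P}(\lambda)\langle n\rangle$ in $(\mathcal{P}^\mu_n)^n$, i.e. the number of $g\in G^\mu_{n-1}$ with $\deg g=n$ and $\lambda_g=\lambda$. *)

theory Defs
  imports Complex_Main "HOL-Library.Poly_Mapping" "HOL-Library.Extended_Nat" "HOL-Library.Product_Plus"
begin

section \<open>The quiver\<close>

text \<open>The weight \<open>a\<epsilon> + b\<delta>\<close> is the pair \<open>(a, b)\<close>.\<close>

type_synonym weight = "int \<times> int"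

definition Lambda_odd :: "weight set" where
  "Lambda_odd = {(2 * n + 1, 2 * k - n) | n k. True}"

text \<open>The constructors \<open>Af'\<close>, \<open>Ag'\<close> are the arrows $f'$, $g'$. At most one arrow of each kind
  starts at a given vertex, so an arrow is determined by its kind and its source. The arrows
  $q$, $f'$, $g'$ start at \<open>(-a-2, b)\<close>; for them the first coordinate of the source is
  \<open>c = -a-2\<close>, that is, \<open>a = -c-2\<close>.\<close>

datatype arrow = Af | Ag | Ap | Aq | Af' | Ag'

fun has_arrow :: "arrow \<Rightarrow> weight \<Rightarrow> bool" where
  "has_arrow Af (a, b) \<longleftrightarrow> a \<ge> 1"
| "has_arrow Ag (a, b) \<longleftrightarrow> a \<ge> 3"
| "has_arrow Ap (a, b) \<longleftrightarrow> a \<ge> 1"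
| "has_arrow Aq (c, b) \<longleftrightarrow> - c - 2 \<ge> 1"
| "has_arrow Af' (c, b) \<longleftrightarrow> - c - 2 \<ge> -1"
| "has_arrow Ag' (c, b) \<longleftrightarrow> - c - 2 \<ge> 1"

fun arrow_target :: "arrow \<Rightarrow> weight \<Rightarrow> weight" where
  "arrow_target Af (a, b) = (a + 2, b + 1)"
| "arrow_target Ag (a, b) = (a - 2, b + 1)"
| "arrow_target Ap (a, b) = (- a - 2, b)"
| "arrow_target Aq (c, b) = (- c - 2, b)"
| "arrow_target Af' (c, b) = (c - 2, b + 1)"
| "arrow_target Ag' (c, b) = (c + 2, b + 1)"

text \<open>Words are written as in the text, right to left: the last letter is the first arrow.
  The empty word at a vertex is the trivial path.\<close>

fun end_of :: "arrow list \<Rightarrow> weight \<Rightarrow> weight" where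
  "end_of [] v = v"
| "end_of (x # w) v = arrow_target x (end_of w v)"

fun is_path :: "arrow list \<Rightarrow> weight \<Rightarrow> bool" where
  "is_path [] v \<longleftrightarrow> v \<in> Lambda_odd"
| "is_path (x # w) v \<longleftrightarrow> is_path w v \<and> has_arrow x (end_of w v)"

lemma zero_weight_Lambda_odd: "(1, 0) \<in> Lambda_odd"
  unfolding Lambda_odd_def by (rule CollectI, rule exI[of _ 0], rule exI[of _ 0]) simp

typedef path = "{(w, v). is_path w v}"
  morphisms rep_path Abs_path
  using zero_weight_Lambda_odd by (intro exI[of _ "([], (1, 0))"]) simp

definition word :: "path \<Rightarrow> arrow list" where "word p = fst (rep_path p)"
definition source :: "path \<Rightarrow> weight" where "source p = snd (rep_path p)"
definition target :: "path \<Rightarrow> weight" where "target p = end_of (word p) (source p)"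

definition plen :: "path \<Rightarrow> nat" where "plen p = length (word p)"

text \<open>\<open>comp_path p q\<close> (first \<open>q\<close>, then \<open>p\<close>) is meaningful only if \<open>source p = target q\<close>.\<close>

definition comp_path :: "path \<Rightarrow> path \<Rightarrow> path" where
  "comp_path p q = Abs_path (word p @ word q, source q)"

lemma end_of_append: "end_of (w @ w') v = end_of w (end_of w' v)"
  by (induction w) auto

lemma is_path_rep: "is_path (word p) (source p)"
  using rep_path[of p] by (simp add: word_def source_def case_prod_beta)

lemma is_path_source: "is_path w v \<Longrightarrow> v \<in> Lambda_odd"
  by (induction w) auto

lemma is_path_appendI: "is_path w' v \<Longrightarrow> is_path w (end_of w' v) \<Longrightarrow> is_path (w @ w') v"
  by (induction w) (auto simp: end_of_append)

lemma word_Abs: "is_path w v \<Longrightarrow> word (Abs_path (w, v)) = w"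
  by (simp add: word_def Abs_path_inverse)

lemma source_Abs: "is_path w v \<Longrightarrow> source (Abs_path (w, v)) = v"
  by (simp add: source_def Abs_path_inverse)

lemma is_path_comp: "source p = target q \<Longrightarrow> is_path (word p @ word q) (source q)"
  by (metis is_path_appendI is_path_rep target_def)

lemma comp_path_simps:
  assumes "source p = target q"
  shows "word (comp_path p q) = word p @ word q"
    and "source (comp_path p q) = source q"
    and "target (comp_path p q) = target p"
    and "plen (comp_path p q) = plen p + plen q"
  using is_path_comp[OF assms] assms
  by (simp_all add: comp_path_def word_Abs source_Abs target_def end_of_append plen_def)

lemma comp_path_assoc:
  assumes "source p = target q" "source q = target r"
  shows "comp_path (comp_path p q) r = comp_path p (comp_path q r)"
  using assms by (simp add: comp_path_def[of "comp_path p q" r] comp_path_def[of p "comp_path q r"] comp_path_simps)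

section \<open>The path algebra \<open>\<complex>Q\<close>\<close>

text \<open>\<open>path \<Rightarrow>\<^sub>0 complex\<close> consists of the finitely supported functions on the set of paths.\<close>

type_synonym path_alg = "path \<Rightarrow>\<^sub>0 complex"

definition path_mult :: "path_alg \<Rightarrow> path_alg \<Rightarrow> path_alg" where
  "path_mult x y =
    (\<Sum>p\<in>Poly_Mapping.keys x. \<Sum>q\<in>Poly_Mapping.keys y.
      if source p = target q
      then Poly_Mapping.single (comp_path p q) (Poly_Mapping.lookup x p * Poly_Mapping.lookup y q)
      else 0)"

lemma path_mult_superset:
  assumes "finite S" "finite T" "Poly_Mapping.keys x \<subseteq> S" "Poly_Mapping.keys y \<subseteq> T"
  shows "path_mult x y =
    (\<Sum>p\<in>S. \<Sum>q\<in>T.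
      if source p = target q
      then Poly_Mapping.single (comp_path p q) (Poly_Mapping.lookup x p * Poly_Mapping.lookup y q)
      else 0)"
proof -
  have "path_mult x y = (\<Sum>p\<in>Poly_Mapping.keys x. \<Sum>q\<in>T.
      if source p = target q
      then Poly_Mapping.single (comp_path p q) (Poly_Mapping.lookup x p * Poly_Mapping.lookup y q)
      else 0)"
    unfolding path_mult_def using assms
    by (intro sum.cong refl sum.mono_neutral_left) (auto simp: in_keys_iff)
  also have "\<dots> = (\<Sum>p\<in>S. \<Sum>q\<in>T.
      if source p = target q
      then Poly_Mapping.single (comp_path p q) (Poly_Mapping.lookup x p * Poly_Mapping.lookup y q)
      else 0)"
    using assms by (intro sum.mono_neutral_left) (auto simp: in_keys_iff intro!: sum.neutral)
  finally show ?thesis .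
qed

lemma path_mult_add_left: "path_mult (x + x') y = path_mult x y + path_mult x' y"
proof -
  let ?S = "Poly_Mapping.keys x \<union> Poly_Mapping.keys x'" and ?T = "Poly_Mapping.keys y"
  have "Poly_Mapping.keys (x + x') \<subseteq> ?S" by (rule Poly_Mapping.keys_add)
  then show ?thesis
    by (subst (1 2 3) path_mult_superset[of ?S ?T])
       (auto simp: sum.distrib[symmetric] lookup_add distrib_right single_add intro!: sum.cong)
qed

lemma path_mult_add_right: "path_mult x (y + y') = path_mult x y + path_mult x y'"
proof -
  let ?S = "Poly_Mapping.keys x" and ?T = "Poly_Mapping.keys y \<union> Poly_Mapping.keys y'"
  have "Poly_Mapping.keys (y + y') \<subseteq> ?T" by (rule Poly_Mapping.keys_add)
  then show ?thesis
    by (subst (1 2 3) path_mult_superset[of ?S ?T])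
       (auto simp: sum.distrib[symmetric] lookup_add distrib_left single_add intro!: sum.cong)
qed

lemma path_mult_zero_left [simp]: "path_mult 0 y = 0"
  by (simp add: path_mult_def)

lemma path_mult_zero_right [simp]: "path_mult x 0 = 0"
  by (simp add: path_mult_def)

lemma path_mult_diff_left: "path_mult (x - x') y = path_mult x y - path_mult x' y"
  by (metis add_diff_cancel_right' diff_add_cancel path_mult_add_left)

lemma path_mult_diff_right: "path_mult x (y - y') = path_mult x y - path_mult x y'"
  by (metis add_diff_cancel_right' diff_add_cancel path_mult_add_right)

lemma path_mult_single:
  "path_mult (Poly_Mapping.single p c) (Poly_Mapping.single q d) =
    (if source p = target q then Poly_Mapping.single (comp_path p q) (c * d) else 0)"
  by (subst path_mult_superset[of "{p}" "{q}"]) auto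

lemma path_alg_induct:
  assumes "P 0" "\<And>p c x. P x \<Longrightarrow> P (Poly_Mapping.single p c + x)"
  shows "P (x :: path_alg)"
proof -
  have "finite K \<Longrightarrow> Poly_Mapping.keys x \<subseteq> K \<Longrightarrow> P x" for K and x :: path_alg
  proof (induction K arbitrary: x rule: finite_induct)
    case empty
    then show ?case using assms(1) by simp
  next
    case (insert k K)
    let ?c = "Poly_Mapping.lookup x k"
    let ?y = "x - Poly_Mapping.single k ?c"
    have "Poly_Mapping.keys ?y \<subseteq> K"
      using insert.prems by (auto simp: in_keys_iff lookup_minus lookup_single when_def split: if_splits)
    then have "P ?y" by (rule insert.IH)
    then have "P (Poly_Mapping.single k ?c + ?y)" by (rule assms(2))
    then show ?case by simp
  qed
  then show ?thesis by (meson finite_keys order_refl)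
qed

lemma path_mult_assoc: "path_mult (path_mult x y) z = path_mult x (path_mult y z)"
proof -
  have 1: "path_mult (path_mult (Poly_Mapping.single p c) (Poly_Mapping.single q d)) (Poly_Mapping.single r e) =
        path_mult (Poly_Mapping.single p c) (path_mult (Poly_Mapping.single q d) (Poly_Mapping.single r e))"
    for p q r c d e
    by (auto simp: path_mult_single comp_path_simps comp_path_assoc mult.assoc)
  have 2: "path_mult (path_mult (Poly_Mapping.single p c) (Poly_Mapping.single q d)) z =
        path_mult (Poly_Mapping.single p c) (path_mult (Poly_Mapping.single q d) z)"
    for p q c d
    by (induction z rule: path_alg_induct) (simp_all add: path_mult_add_right 1)
  have 3: "path_mult (path_mult (Poly_Mapping.single p c) y) z =
        path_mult (Poly_Mapping.single p c) (path_mult y z)"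
    for p c
    by (induction y rule: path_alg_induct) (simp_all add: path_mult_add_right path_mult_add_left 2)
  show ?thesis
    by (induction x rule: path_alg_induct) (simp_all add: path_mult_add_left 3)
qed

section \<open>The relations and the algebra \<open>\<A>\<close>\<close>

text \<open>\<open>mon c w v\<close> is \<open>c\<close> times the path with word \<open>w\<close> and source \<open>v\<close>, and \<open>0\<close> if this is not a
  path of the quiver; this implements the omission of such monomials in the relations.\<close>

definition mon :: "complex \<Rightarrow> arrow list \<Rightarrow> weight \<Rightarrow> path_alg" where
  "mon c w v = (if is_path w v then Poly_Mapping.single (Abs_path (w, v)) c else 0)"

text \<open>In each rule \<open>s\<close> and \<open>s'\<close> are the vertices \<open>(a, b)\<close> and \<open>(-a-2, b)\<close>.\<close>

inductive_set relations :: "path_alg set" where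
  ge3: "\<lbrakk>(a, b) \<in> Lambda_odd; a \<ge> 3; s = (a, b); s' = (- a - 2, b);
     x \<in> {mon 1 [Af, Af] s,
          mon 1 [Ag, Ag] s,
          mon 1 [Af', Af'] s',
          mon 1 [Ag', Ag'] s',
          mon 1 [Aq, Ap] s,
          mon 1 [Af, Ag] s + mon ((of_int a - 1) / (of_int a + 3)) [Ag, Af] s,
          mon 1 [Af', Ag'] s' + mon (((of_int a - 1) / (of_int a + 3))\<^sup>2) [Ag', Af'] s',
          mon 1 [Af', Ap] s - mon (of_int a + 1) [Ap, Af] s,
          mon 1 [Aq, Af'] s' - mon (of_int a + 3) [Af, Aq] s',
          mon 1 [Ag', Ap] s - mon (of_int a + 1) [Ap, Ag] s,
          mon 1 [Aq, Ag'] s' - mon (of_int a - 1) [Ag, Aq] s'}\<rbrakk>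
   \<Longrightarrow> x \<in> relations"
| eq1: "\<lbrakk>(1, b) \<in> Lambda_odd; s = (1, b); s' = (-3, b);
     x \<in> {mon 1 [Af, Af] s,
          mon 1 [Af', Af'] s',
          mon 1 [Aq, Ap] s,
          mon 1 [Af', Ag'] s' - mon (1 / 16) [Ag', Af'] s',
          mon 1 [Af', Ap] s - mon 2 [Ap, Af] s,
          mon 1 [Aq, Af'] s' - mon 4 [Af, Aq] s'}\<rbrakk>
   \<Longrightarrow> x \<in> relations"
| eq_minus1: "\<lbrakk>(-1, b) \<in> Lambda_odd; s' = (-1, b);
     x \<in> {mon 1 [Af', Af'] s', mon 1 [Ag', Af'] s'}\<rbrakk>
   \<Longrightarrow> x \<in> relations"

text \<open>The two-sided ideal generated by the relations. Every element of \<open>\<complex>Q\<close> is fixed by a finite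
  sum of trivial paths, so closure under multiplication gives closure under scalars.\<close>

inductive_set rel_ideal :: "path_alg set" where
  zero: "0 \<in> rel_ideal"
| rel: "x \<in> relations \<Longrightarrow> x \<in> rel_ideal"
| diff: "x \<in> rel_ideal \<Longrightarrow> y \<in> rel_ideal \<Longrightarrow> x - y \<in> rel_ideal"
| mult_left: "x \<in> rel_ideal \<Longrightarrow> path_mult r x \<in> rel_ideal"
| mult_right: "x \<in> rel_ideal \<Longrightarrow> path_mult x r \<in> rel_ideal"

lemma rel_ideal_uminus: "x \<in> rel_ideal \<Longrightarrow> - x \<in> rel_ideal"
  using rel_ideal.diff[OF rel_ideal.zero] by simp

lemma rel_ideal_add: "x \<in> rel_ideal \<Longrightarrow> y \<in> rel_ideal \<Longrightarrow> x + y \<in> rel_ideal"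
  using rel_ideal.diff[OF _ rel_ideal_uminus] by fastforce

definition ideal_cong :: "path_alg \<Rightarrow> path_alg \<Rightarrow> bool" where
  "ideal_cong x y \<longleftrightarrow> x - y \<in> rel_ideal"

lemma equivp_ideal_cong: "equivp ideal_cong"
proof (rule equivpI)
  show "reflp ideal_cong"
    by (simp add: reflp_def ideal_cong_def rel_ideal.zero)
  show "symp ideal_cong"
    by (metis ideal_cong_def minus_diff_eq rel_ideal_uminus sympI)
  show "transp ideal_cong"
  proof (rule transpI)
    fix x y z assume "ideal_cong x y" "ideal_cong y z"
    moreover have "x - z = (x - y) + (y - z)" by simp
    ultimately show "ideal_cong x z"
      unfolding ideal_cong_def by (metis rel_ideal_add)
  qed
qed

quotient_type alg = path_alg / ideal_cong
  morphisms rep_alg to_alg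
  by (rule equivp_ideal_cong)

text \<open>\<open>\<A>\<close> has local units only; the class \<open>ring\<close> does not ask for a unit.\<close>

instantiation alg :: ring
begin

lift_definition zero_alg :: alg is 0 .

lift_definition plus_alg :: "alg \<Rightarrow> alg \<Rightarrow> alg" is "(+)"
  proof -
  fix x x' y y' assume "ideal_cong x x'" "ideal_cong y y'"
  moreover have "x + y - (x' + y') = (x - x') + (y - y')" by (simp add: algebra_simps)
  ultimately show "ideal_cong (x + y) (x' + y')"
    unfolding ideal_cong_def by (metis rel_ideal_add)
qed

lift_definition uminus_alg :: "alg \<Rightarrow> alg" is uminus
  proof -
  fix x x' assume "ideal_cong x x'"
  moreover have "- x - (- x') = - (x - x')" by simp
  ultimately show "ideal_cong (- x) (- x')"
    unfolding ideal_cong_def by (metis rel_ideal_uminus)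
qed

lift_definition minus_alg :: "alg \<Rightarrow> alg \<Rightarrow> alg" is "(-)"
  proof -
  fix x x' y y' assume "ideal_cong x x'" "ideal_cong y y'"
  moreover have "x - y - (x' - y') = (x - x') - (y - y')" by (simp add: algebra_simps)
  ultimately show "ideal_cong (x - y) (x' - y')"
    unfolding ideal_cong_def by (metis rel_ideal.diff)
qed

lift_definition times_alg :: "alg \<Rightarrow> alg \<Rightarrow> alg" is path_mult
proof -
  fix x x' y y' assume a: "ideal_cong x x'" "ideal_cong y y'"
  have "path_mult x y - path_mult x' y' = path_mult (x - x') y + path_mult x' (y - y')"
    by (simp add: path_mult_diff_left path_mult_diff_right)
  then show "ideal_cong (path_mult x y) (path_mult x' y')"
    using a by (simp add: ideal_cong_def rel_ideal_add rel_ideal.mult_left rel_ideal.mult_right)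
qed

instance
proof
  fix a b c :: alg
  show "a + b + c = a + (b + c)" by transfer (simp add: ideal_cong_def add.assoc rel_ideal.zero)
  show "a + b = b + a" by transfer (simp add: ideal_cong_def add.commute rel_ideal.zero)
  show "0 + a = a" by transfer (simp add: ideal_cong_def rel_ideal.zero)
  show "- a + a = 0" by transfer (simp add: ideal_cong_def rel_ideal.zero)
  show "a - b = a + - b" by transfer (simp add: ideal_cong_def rel_ideal.zero)
  show "a * b * c = a * (b * c)"
    by transfer (simp add: ideal_cong_def path_mult_assoc rel_ideal.zero)
  show "(a + b) * c = a * c + b * c"
    by transfer (simp add: ideal_cong_def path_mult_add_left rel_ideal.zero)
  show "a * (b + c) = a * b + a * c"
    by transfer (simp add: ideal_cong_def path_mult_add_right rel_ideal.zero)
qed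

end

definition idem :: "weight \<Rightarrow> alg" where
  "idem v = to_alg (mon 1 [] v)"

definition alg_degree :: "int \<Rightarrow> alg set" where
  "alg_degree i = to_alg ` {x. \<forall>p\<in>Poly_Mapping.keys x. int (plen p) = i}"

definition proj :: "weight \<Rightarrow> alg set" where
  "proj v = {x * idem v | x. True}"

lemma keys_mon: "p \<in> Poly_Mapping.keys (mon c w v) \<Longrightarrow> plen p = length w"
  by (auto simp: mon_def plen_def word_Abs split: if_splits)

lemma lookup_mon: "plen p \<noteq> length w \<Longrightarrow> Poly_Mapping.lookup (mon c w v) p = 0"
  using keys_mon by (metis in_keys_iff)

lemma lookup_path_mult_nonzero:
  assumes "Poly_Mapping.lookup (path_mult x y) r \<noteq> 0"
  shows "\<exists>p\<in>Poly_Mapping.keys x. \<exists>q\<in>Poly_Mapping.keys y. source p = target q \<and> r = comp_path p q"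
proof (rule ccontr)
  assume "\<not> ?thesis"
  then have "Poly_Mapping.lookup (path_mult x y) r = 0"
    unfolding path_mult_def lookup_sum
    by (intro sum.neutral ballI) (auto simp: lookup_single when_def)
  with assms show False by simp
qed

lemma rel_ideal_lookup: "x \<in> rel_ideal \<Longrightarrow> plen p < 2 \<Longrightarrow> Poly_Mapping.lookup x p = 0"
proof (induction x arbitrary: p rule: rel_ideal.induct)
  case (rel x)
  from rel(1) show ?case
    by cases (use rel(2) in \<open>auto simp: lookup_add lookup_minus lookup_mon\<close>)
next
  case (mult_left x r)
  show ?case
  proof (rule ccontr)
    assume "\<not> ?case"
    from lookup_path_mult_nonzero[OF this] obtain q q' where
      "q' \<in> Poly_Mapping.keys x" "source q = target q'" "p = comp_path q q'" by blast
    with mult_left show False by (auto simp: comp_path_simps in_keys_iff)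
  qed
next
  case (mult_right x r)
  show ?case
  proof (rule ccontr)
    assume "\<not> ?case"
    from lookup_path_mult_nonzero[OF this] obtain q q' where
      "q \<in> Poly_Mapping.keys x" "source q = target q'" "p = comp_path q q'" by blast
    with mult_right show False by (auto simp: comp_path_simps in_keys_iff)
  qed
qed (simp_all add: lookup_minus)

text \<open>The coefficient of the trivial path \<open>e\<^sub>v\<close> (for \<open>v\<close> in \<open>Lambda_odd\<close>). Restricted to
  \<open>proj v\<close> it is the canonical surjection onto the simple module \<open>\<complex>e\<^sub>v\<close>, whose underlying space
  is identified with \<open>\<complex>\<close>.\<close>

lift_definition top_coeff :: "weight \<Rightarrow> alg \<Rightarrow> complex" is
  "\<lambda>v x. if v \<in> Lambda_odd then Poly_Mapping.lookup x (Abs_path ([], v)) else 0"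
proof -
  fix v and x y :: path_alg assume "ideal_cong x y"
  then have "x - y \<in> rel_ideal" by (simp add: ideal_cong_def)
  from rel_ideal_lookup[OF this, of "Abs_path ([], v)"]
  show "(if v \<in> Lambda_odd then Poly_Mapping.lookup x (Abs_path ([], v)) else 0) =
        (if v \<in> Lambda_odd then Poly_Mapping.lookup y (Abs_path ([], v)) else 0)"
    by (simp add: plen_def word_Abs lookup_minus)
qed

section \<open>Graded projective modules\<close>

text \<open>The data of \<open>\<Oplus>\<^sub>j \<P>(wt j)\<langle>dg j\<rangle>\<close>, where \<open>j\<close> runs over \<open>idx\<close>. Its elements are the finitely
  supported families \<open>x :: 'i \<Rightarrow>\<^sub>0 alg\<close> with \<open>x\<^sub>j \<in> \<P>(wt j)\<close>.\<close>

record 'i graded_proj =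
  idx :: "'i set"
  wt :: "'i \<Rightarrow> weight"
  dg :: "'i \<Rightarrow> int"

definition elements :: "'i graded_proj \<Rightarrow> ('i \<Rightarrow>\<^sub>0 alg) set" where
  "elements F = {x. Poly_Mapping.keys x \<subseteq> idx F \<and> (\<forall>j\<in>idx F. Poly_Mapping.lookup x j \<in> proj (wt F j))}"

definition act :: "alg \<Rightarrow> ('i \<Rightarrow>\<^sub>0 alg) \<Rightarrow> ('i \<Rightarrow>\<^sub>0 alg)" where
  "act r x = Poly_Mapping.map (\<lambda>y. r * y) x"

text \<open>\<open>component F v i\<close> is \<open>(e\<^sub>v M)\<^sub>i\<close> for the module \<open>M\<close> given by \<open>F\<close>; the shift of degrees follows
  the convention \<open>M\<langle>n\<rangle>\<^sub>i = M\<^bsub>i-n\<^esub>\<close>.\<close>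

definition component :: "'i graded_proj \<Rightarrow> weight \<Rightarrow> int \<Rightarrow> ('i \<Rightarrow>\<^sub>0 alg) set" where
  "component F v i =
    {x \<in> elements F. x \<in> act (idem v) ` elements F \<and>
       (\<forall>j\<in>idx F. Poly_Mapping.lookup x j \<in> alg_degree (i - dg F j))}"

definition homogeneous :: "'i graded_proj \<Rightarrow> ('i \<Rightarrow>\<^sub>0 alg) \<Rightarrow> bool" where
  "homogeneous F x \<longleftrightarrow> (\<exists>v\<in>Lambda_odd. \<exists>i. x \<in> component F v i)"

text \<open>The submodule generated by \<open>S\<close>. The elements of \<open>S\<close> are of the form \<open>e x\<close> with \<open>e\<close> a finite
  sum of idempotents whenever they lie in some \<open>elements F\<close>, so again closure under scalars is
  automatic.\<close>

definition generated :: "('i \<Rightarrow>\<^sub>0 alg) set \<Rightarrow> ('i \<Rightarrow>\<^sub>0 alg) set" where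
  "generated S = \<Inter>{N. S \<subseteq> N \<and> 0 \<in> N \<and> (\<forall>x\<in>N. \<forall>y\<in>N. x - y \<in> N) \<and> (\<forall>r. \<forall>x\<in>N. act r x \<in> N)}"

definition minimal_hom_generating_set ::
  "'i graded_proj \<Rightarrow> ('i \<Rightarrow>\<^sub>0 alg) set \<Rightarrow> ('i \<Rightarrow>\<^sub>0 alg) set \<Rightarrow> bool" where
  "minimal_hom_generating_set F K G \<longleftrightarrow>
    (\<forall>x\<in>G. homogeneous F x) \<and> generated G = K \<and> (\<forall>H. H \<subset> G \<longrightarrow> generated H \<noteq> K)"

section \<open>The minimal resolution\<close>

text \<open>\<open>R n\<close> is the module \<open>\<P>\<^sub>n\<close>. For \<open>n \<ge> 1\<close> its summands are indexed by labels \<open>j\<close> for the elements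
  \<open>gen n j\<close> of the chosen minimal generating set \<open>G\<^bsub>n-1\<^esub> = gen n ` idx (R n)\<close>: using the elements of
  \<open>G\<^bsub>n-1\<^esub>\<close> themselves as indices would make the type of the elements of \<open>\<P>\<^sub>n\<close> depend on \<open>n\<close>.
  \<open>\<A>\<close> has countable dimension, so countably many labels suffice for every choice of the \<open>G\<^bsub>n\<^esub>\<close>.
  The value \<open>gen 0\<close> plays no role.\<close>

definition aug :: "weight \<Rightarrow> ('i \<Rightarrow>\<^sub>0 alg) \<Rightarrow> complex" where
  "aug \<mu> x = (\<Sum>j\<in>Poly_Mapping.keys x. top_coeff \<mu> (Poly_Mapping.lookup x j))"

definition diff_map :: "('i \<Rightarrow> ('i \<Rightarrow>\<^sub>0 alg)) \<Rightarrow> ('i \<Rightarrow>\<^sub>0 alg) \<Rightarrow> ('i \<Rightarrow>\<^sub>0 alg)" where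
  "diff_map h x = (\<Sum>j\<in>Poly_Mapping.keys x. act (Poly_Mapping.lookup x j) (h j))"

fun ker_phi ::
  "weight \<Rightarrow> (nat \<Rightarrow> 'i graded_proj) \<Rightarrow> (nat \<Rightarrow> 'i \<Rightarrow> ('i \<Rightarrow>\<^sub>0 alg)) \<Rightarrow> nat \<Rightarrow> ('i \<Rightarrow>\<^sub>0 alg) set" where
  "ker_phi \<mu> R gen 0 = {x \<in> elements (R 0). aug \<mu> x = 0}"
| "ker_phi \<mu> R gen (Suc n) = {x \<in> elements (R (Suc n)). diff_map (gen (Suc n)) x = 0}"

definition minimal_resolution ::
  "weight \<Rightarrow> (nat \<Rightarrow> 'i graded_proj) \<Rightarrow> (nat \<Rightarrow> 'i \<Rightarrow> ('i \<Rightarrow>\<^sub>0 alg)) \<Rightarrow> bool" where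
  "minimal_resolution \<mu> R gen \<longleftrightarrow>
    (\<exists>j. idx (R 0) = {j} \<and> wt (R 0) j = \<mu> \<and> dg (R 0) j = 0) \<and>
    (\<forall>n. inj_on (gen (Suc n)) (idx (R (Suc n))) \<and>
         minimal_hom_generating_set (R n) (ker_phi \<mu> R gen n) (gen (Suc n) ` idx (R (Suc n))) \<and>
         (\<forall>j\<in>idx (R (Suc n)). wt (R (Suc n)) j \<in> Lambda_odd \<and>
            gen (Suc n) j \<in> component (R n) (wt (R (Suc n)) j) (dg (R (Suc n)) j)))"

definition linear_part :: "(nat \<Rightarrow> 'i graded_proj) \<Rightarrow> nat \<Rightarrow> 'i graded_proj" where
  "linear_part R n = (R n)\<lparr>idx := {j \<in> idx (R n). dg (R n) j = int n}\<rparr>"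

text \<open>The number of summands \<open>\<P>(v)\<langle>d\<rangle>\<close>, with value \<open>\<infinity>\<close> if there are infinitely many.\<close>

definition multiplicity :: "'i graded_proj \<Rightarrow> weight \<Rightarrow> int \<Rightarrow> enat" where
  "multiplicity F v d =
    (let J = {j \<in> idx F. wt F j = v \<and> dg F j = d} in if finite J then enat (card J) else \<infinity>)"

definition N_mult :: "(nat \<Rightarrow> 'i graded_proj) \<Rightarrow> nat \<Rightarrow> weight \<Rightarrow> enat" where
  "N_mult R n v = multiplicity (linear_part R n) v (int n)"

text \<open>\<open>{2n, 2n-4, \<dots>, -2n}\<close> for \<open>n \<ge> 0\<close>, and the empty set for \<open>n = -1\<close>.\<close>

definition M_set :: "int \<Rightarrow> int set" where
  "M_set n = {2 * n - 4 * j | j. 0 \<le> j \<and> j \<le> n}"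

end

(*
  The multiplicities on the diagonal only involve the quadratic data: the relations of degree two.
  After rescaling the arrows, every relation of the algebra says that the sum of all paths of length
  two between two given vertices is zero, except for pq, for gf and g'p starting at a = 1 and for
  qf' starting at a = -1, which are subject to no relation. Consequently an element of degree n + 1
  and weight v in the kernel of phi_n is a family of scalars, one for each vertex nu of level n (the
  weights of the generators of degree n) with an arrow to v. The kernel condition says that two such
  scalars agree when their vertices have a common predecessor in level n - 1, and that a scalar
  vanishes when a path of length two from level n - 1 through its vertex is either one of the
  exceptions or has a partner that leaves level n. In coordinates that count the letters f, g and
  p or q of a path one reads off that the solution space has dimension at most one, and for which
  weights v it is nonzero; these form level n + 1.
*)
theory Submission
  imports Defs
begin

section \<open>The rescaled arrows\<close>

text \<open>No basis of the algebra is computed. Two facts replace it: the ideal starts in degree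
  two, so coefficients of paths of length 0 and 1 survive in the quotient, and for each pair of
  vertices an explicit functional on words of length two kills the ideal. The relations put elements
  into the kernel; the functional shows that there are no others. Generators off the diagonal are
  left uncontrolled. By induction all generators of \<open>R n\<close> have degree at least n. In a
  kernel element of degree n + 1, entries at generators of degree above n + 1 have negative degree,
  and entries at degree n + 1 are multiples of idempotents, which minimality excludes. Only arrows
  out of the diagonal remain. The generating sets are arbitrary, so each diagonal generator carries
  an unknown nonzero scalar, and the linear differential is tracked only up to rescaling of rows and
  columns. Three of the exceptions occur at the walls a = 1 and a = -1, where an anticommuting
  square loses a side (fg, pg and fq are not paths there) and the surviving path is not
  killed.\<close>

lemma Lambda_odd_iff: "(a, b) \<in> Lambda_odd \<longleftrightarrow> odd a \<and> even (b + (a - 1) div 2)"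
proof
  assume "(a, b) \<in> Lambda_odd"
  then show "odd a \<and> even (b + (a - 1) div 2)" by (auto simp: Lambda_odd_def)
next
  assume h: "odd a \<and> even (b + (a - 1) div 2)"
  then obtain n where n: "a = 2 * n + 1" by (auto elim: oddE)
  with h have "even (b + n)" by simp
  then obtain k where "b + n = 2 * k" by (rule evenE)
  then have "b = 2 * k - n" by simp
  with n show "(a, b) \<in> Lambda_odd" by (auto simp: Lambda_odd_def)
qed

lemma arrow_target_Lambda_odd:
  assumes "v \<in> Lambda_odd"
  shows "arrow_target x v \<in> Lambda_odd"
proof -
  obtain n k where "v = (2 * n + 1, 2 * k - n)" using assms by (auto simp: Lambda_odd_def)
  then show ?thesis by (cases x) (auto simp: Lambda_odd_iff)
qed

lemma end_of_Lambda_odd: "is_path w v \<Longrightarrow> end_of w v \<in> Lambda_odd"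
  by (induction w) (auto simp: arrow_target_Lambda_odd)

lemma is_path_append: "is_path (w @ w') v \<longleftrightarrow> is_path w' v \<and> is_path w (end_of w' v)"
  by (induction w) (auto simp: end_of_append end_of_Lambda_odd)

lemma path_mult_mon:
  "path_mult (mon c w v) (mon d w' v') =
     (if is_path w v \<and> end_of w' v' = v then mon (c * d) (w @ w') v' else 0)"
  by (auto simp: mon_def path_mult_single source_Abs target_def word_Abs comp_path_def is_path_append)

lemma mon_zero [simp]: "mon 0 w v = 0"
  by (simp add: mon_def)

lemma mon_add: "mon c w v + mon d w v = mon (c + d) w v"
  by (simp add: mon_def single_add)

lemma mon_diff_mon: "mon c w v - mon d w' v' = mon c w v + mon (- d) w' v'"
  by (simp add: mon_def single_uminus)

lemma to_alg_mult: "to_alg x * to_alg y = to_alg (path_mult x y)"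
  by (simp add: times_alg.abs_eq)

lemma to_alg_add: "to_alg x + to_alg y = to_alg (x + y)"
  by (simp add: plus_alg.abs_eq)

lemma to_alg_eq_0: "to_alg x = 0 \<longleftrightarrow> x \<in> rel_ideal"
  by (simp add: zero_alg.abs_eq alg.abs_eq_iff ideal_cong_def)

lemma to_alg_0 [simp]: "to_alg 0 = 0"
  by (simp add: zero_alg.abs_eq)

lemma to_alg_sum: "to_alg (sum f S) = (\<Sum>x\<in>S. to_alg (f x))"
  by (induction S rule: infinite_finite_induct) (simp_all flip: to_alg_add)

lemma to_alg_cases: obtains X where "x = to_alg X"
  by (metis Quotient3_abs_rep Quotient3_alg)

text \<open>\<open>\<A>\<close> carries no scalar multiplication; multiplication by \<open>scl c v\<close> is its substitute
  on the elements of \<open>e\<^sub>v\<A>\<close>.\<close>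

definition scl :: "complex \<Rightarrow> weight \<Rightarrow> alg" where
  "scl c v = to_alg (mon c [] v)"

lemma idem_eq_scl: "idem v = scl 1 v"
  by (simp add: idem_def scl_def)

lemma scl_mult: "scl c v * scl d u = (if u = v then scl (c * d) v else 0)"
  by (auto simp: scl_def to_alg_mult path_mult_mon) (auto simp: mon_def)

lemma scl_0 [simp]: "scl 0 v = 0"
  by (simp add: scl_def)

lemma scl_add: "scl (c + d) v = scl c v + scl d v"
  by (simp add: scl_def to_alg_add mon_add)

lemma scl_mult_mon:
  "scl c v * to_alg (mon d w u) = (if end_of w u = v then to_alg (mon (c * d) w u) else 0)"
  by (auto simp: scl_def to_alg_mult path_mult_mon) (auto simp: mon_def end_of_Lambda_odd)

lemma mon_mult_scl:
  "to_alg (mon d w u) * scl c v = (if u = v then to_alg (mon (d * c) w u) else 0)"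
  by (auto simp: scl_def to_alg_mult path_mult_mon) (auto simp: mon_def)

text \<open>The quiver has no parallel arrows, so an arrow is recovered from its end points. For two
  weights that are not joined the value is arbitrary; \<open>edge\<close> tests for this.\<close>

definition link :: "weight \<Rightarrow> weight \<Rightarrow> arrow" where
  "link \<nu> v =
    (if fst \<nu> \<ge> 1 then if snd v = snd \<nu> then Ap else if fst v = fst \<nu> + 2 then Af else Ag
     else if snd v = snd \<nu> then Aq else if fst v = fst \<nu> - 2 then Af' else Ag')"

definition edge :: "weight \<Rightarrow> weight \<Rightarrow> bool" where
  "edge \<nu> v \<longleftrightarrow> has_arrow (link \<nu> v) \<nu> \<and> arrow_target (link \<nu> v) \<nu> = v"

lemma link_arrow: "has_arrow x \<nu> \<Longrightarrow> link \<nu> (arrow_target x \<nu>) = x"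
  by (cases \<nu>; cases x) (auto simp: link_def)

lemma edge_arrow: "has_arrow x \<nu> \<Longrightarrow> edge \<nu> (arrow_target x \<nu>)"
  by (simp add: edge_def link_arrow)

lemma edge_iff:
  "edge (a, b) v \<longleftrightarrow>
     a \<ge> 1 \<and> (v = (a + 2, b + 1) \<or> v = (- a - 2, b)) \<or> a \<ge> 3 \<and> v = (a - 2, b + 1) \<or>
     a \<le> -3 \<and> (v = (a + 2, b + 1) \<or> v = (- a - 2, b)) \<or> a \<le> -1 \<and> v = (a - 2, b + 1)"
  by (cases v) (auto simp: edge_def link_def split: if_splits)

lemma edge_Lambda_odd: "edge \<nu> v \<Longrightarrow> \<nu> \<in> Lambda_odd \<Longrightarrow> v \<in> Lambda_odd"
  by (metis arrow_target_Lambda_odd edge_def)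

text \<open>With these scalars the rescaled arrows anticommute, so that every relation of \<open>\<A>\<close> says that
  the sum of all rescaled paths of length two between two given vertices vanishes.\<close>

fun scal :: "arrow \<Rightarrow> weight \<Rightarrow> complex" where
  "scal Af (a, b) = 1"
| "scal Ag (a, b) = 1 / ((of_int a - 1) * (of_int a + 1))"
| "scal Ap (a, b) = 1"
| "scal Aq (c, b) = - 1 / (of_int c + 1)"
| "scal Af' (c, b) = (if c = -1 then 1 else 1 / (of_int c + 1))"
| "scal Ag' (c, b) = (if c = -3 then - 1 / 4 else 1 / ((of_int c + 3) * (of_int c + 1)\<^sup>2))"

lemma of_int_plus_numeral_eq_0: "of_int c + numeral k = (0 :: complex) \<longleftrightarrow> c = - numeral k"
  by (metis add_eq_0_iff2 of_int_eq_iff of_int_minus of_int_numeral)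

lemma of_int_plus_one_eq_0: "of_int c + 1 = (0 :: complex) \<longleftrightarrow> c = - 1"
  by (metis add_eq_0_iff2 of_int_1 of_int_eq_iff of_int_minus)

lemma of_int_eq_minus_one: "- 1 = (of_int c :: complex) \<longleftrightarrow> c = - 1"
  by (metis of_int_1 of_int_eq_iff of_int_minus)

lemma of_int_eq_minus_numeral: "- numeral k = (of_int c :: complex) \<longleftrightarrow> c = - numeral k"
  by (metis of_int_eq_iff of_int_minus of_int_numeral)

lemmas of_int_nonzero =
  of_int_plus_numeral_eq_0 of_int_plus_one_eq_0
  of_int_plus_numeral_eq_0[unfolded add.commute[of "of_int _"]]
  of_int_plus_one_eq_0[unfolded add.commute[of "of_int _"]]
  of_int_eq_minus_one of_int_eq_minus_numeral

lemma scal_nonzero: "has_arrow x v \<Longrightarrow> scal x v \<noteq> 0"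
  by (cases v; cases x) (auto simp: of_int_plus_numeral_eq_0 of_int_plus_one_eq_0)

text \<open>The value 0 on pairs that are not joined lets sums run over whole levels without side
  conditions.\<close>

definition arr :: "weight \<Rightarrow> weight \<Rightarrow> alg" where
  "arr \<nu> v = (if edge \<nu> v then to_alg (mon (scal (link \<nu> v) \<nu>) [link \<nu> v] \<nu>) else 0)"

lemma arr_arrow: "has_arrow x \<nu> \<Longrightarrow> arr \<nu> (arrow_target x \<nu>) = to_alg (mon (scal x \<nu>) [x] \<nu>)"
  by (simp add: arr_def edge_arrow link_arrow)

lemma scl_arr: "scl 1 v * arr \<nu> v = arr \<nu> v"
  by (simp add: arr_def scl_mult_mon edge_def)

lemma arr_scl: "arr \<nu> v * scl c \<nu> = scl c v * arr \<nu> v"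
  by (simp add: arr_def scl_mult_mon mon_mult_scl edge_def mult.commute)

text \<open>The pairs of vertices joined by a path of length two on which no relation of \<open>\<A>\<close> is
  supported: \<open>gf\<close> and \<open>g'p\<close> at \<open>a = 1\<close>, \<open>qf'\<close> at \<open>a = -1\<close>, and \<open>pq\<close>.\<close>

definition free_pair :: "weight \<Rightarrow> weight \<Rightarrow> bool" where
  "free_pair \<rho> v \<longleftrightarrow>
     fst \<rho> = 1 \<and> (v = (1, snd \<rho> + 2) \<or> v = (-1, snd \<rho> + 1)) \<or>
     fst \<rho> = -1 \<and> v = (1, snd \<rho> + 1) \<or> fst \<rho> \<le> -3 \<and> v = \<rho>"

definition mids :: "weight \<Rightarrow> weight \<Rightarrow> weight set" where
  "mids \<rho> v = {\<nu>. edge \<rho> \<nu> \<and> edge \<nu> v}"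

section \<open>The relations in terms of the rescaled arrows\<close>

lemma relation_scaled:
  assumes "mon c w s + mon d w' s \<in> relations" "s \<in> Lambda_odd"
  shows "to_alg (mon (c * k) w s) + to_alg (mon (d * k) w' s) = 0"
proof -
  have "path_mult (mon c w s) (mon k [] s) = mon (c * k) w s" for c w
    using assms(2) by (simp add: path_mult_mon) (simp add: mon_def)
  moreover have "path_mult (mon c w s + mon d w' s) (mon k [] s) \<in> rel_ideal"
    by (intro rel_ideal.mult_right rel_ideal.rel assms)
  ultimately show ?thesis
    by (simp add: path_mult_add_left to_alg_add to_alg_eq_0)
qed

lemma relation_scaled_monomial:
  assumes "mon 1 w s \<in> relations" "s \<in> Lambda_odd"
  shows "to_alg (mon k w s) = 0"
  using relation_scaled[of 1 w s 0 w k] assms by simp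

lemma arr_arr:
  assumes "has_arrow y \<rho>" "arrow_target y \<rho> = \<nu>" "has_arrow x \<nu>" "arrow_target x \<nu> = v"
  shows "arr \<nu> v * arr \<rho> \<nu> = to_alg (mon (scal x \<nu> * scal y \<rho>) [x, y] \<rho>)"
  using assms arr_arrow[of y \<rho>] arr_arrow[of x \<nu>]
  by (auto simp: to_alg_mult path_mult_mon) (auto simp: mon_def arrow_target_Lambda_odd)

lemma relations_pos:
  assumes "(a, b) \<in> Lambda_odd" "a \<ge> 3"
  shows "mon 1 [Af, Af] (a, b) \<in> relations" "mon 1 [Ag, Ag] (a, b) \<in> relations"
    "mon 1 [Aq, Ap] (a, b) \<in> relations"
    "mon 1 [Af, Ag] (a, b) + mon ((of_int a - 1) / (of_int a + 3)) [Ag, Af] (a, b) \<in> relations"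
    "mon 1 [Af', Ap] (a, b) + mon (- (of_int a + 1)) [Ap, Af] (a, b) \<in> relations"
    "mon 1 [Ag', Ap] (a, b) + mon (- (of_int a + 1)) [Ap, Ag] (a, b) \<in> relations"
  using assms unfolding mon_diff_mon[symmetric]
  by (auto intro!: relations.ge3[OF assms refl refl])

lemma relations_one:
  assumes "(1, b) \<in> Lambda_odd"
  shows "mon 1 [Af, Af] (1, b) \<in> relations" "mon 1 [Aq, Ap] (1, b) \<in> relations"
    "mon 1 [Af', Ap] (1, b) + mon (- 2) [Ap, Af] (1, b) \<in> relations"
  using assms unfolding mon_diff_mon[symmetric]
  by (auto intro!: relations.eq1[OF assms refl refl])

lemma Lambda_odd_flip: "(c, b) \<in> Lambda_odd \<Longrightarrow> (- c - 2, b) \<in> Lambda_odd"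
  using arrow_target_Lambda_odd[of "(c, b)" Aq] by simp

text \<open>The relations at a vertex (-a-2, b) are indexed by a. Substituting a = -c-2 turns
  (a-1)/(a+3) into (c+3)/(c-1), -(a+3) into c-1, -(a-1) into c+3, and the range a \<ge> 3 into c
  \<le> -5.\<close>

lemma relations_neg:
  assumes "(c, b) \<in> Lambda_odd" "c \<le> -5"
  shows "mon 1 [Af', Af'] (c, b) \<in> relations" "mon 1 [Ag', Ag'] (c, b) \<in> relations"
    "mon 1 [Af', Ag'] (c, b) + mon (((of_int c + 3) / (of_int c - 1))\<^sup>2) [Ag', Af'] (c, b) \<in> relations"
    "mon 1 [Aq, Af'] (c, b) + mon (of_int c - 1) [Af, Aq] (c, b) \<in> relations"
    "mon 1 [Aq, Ag'] (c, b) + mon (of_int c + 3) [Ag, Aq] (c, b) \<in> relations"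
proof -
  have r: "(of_int (- c - 2) - 1) / (of_int (- c - 2) + 3 :: complex) = (of_int c + 3) / (of_int c - 1)"
  proof -
    have "of_int (- c - 2) - 1 = (- (of_int c + 3) :: complex)"
      "of_int (- c - 2) + 3 = (- (of_int c - 1) :: complex)" by simp_all
    then show ?thesis by (metis minus_divide_divide)
  qed
  show "mon 1 [Af', Af'] (c, b) \<in> relations" "mon 1 [Ag', Ag'] (c, b) \<in> relations"
    using assms(2) by (auto intro!: relations.ge3[OF Lambda_odd_flip[OF assms(1)] _ refl refl])
  show "mon 1 [Af', Ag'] (c, b) + mon (((of_int c + 3) / (of_int c - 1))\<^sup>2) [Ag', Af'] (c, b) \<in> relations"
    unfolding r[symmetric]
    using assms(2) by (intro relations.ge3[OF Lambda_odd_flip[OF assms(1)] _ refl refl]) auto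
  have 1: "of_int c - 1 = - (of_int (- c - 2) + 3 :: complex)"
    and 2: "of_int c + 3 = - (of_int (- c - 2) - 1 :: complex)" by simp_all
  show "mon 1 [Aq, Af'] (c, b) + mon (of_int c - 1) [Af, Aq] (c, b) \<in> relations"
    unfolding 1 mon_diff_mon[symmetric]
    using assms(2) by (intro relations.ge3[OF Lambda_odd_flip[OF assms(1)] _ refl refl]) auto
  show "mon 1 [Aq, Ag'] (c, b) + mon (of_int c + 3) [Ag, Aq] (c, b) \<in> relations"
    unfolding 2 mon_diff_mon[symmetric]
    using assms(2) by (intro relations.ge3[OF Lambda_odd_flip[OF assms(1)] _ refl refl]) auto
qed

lemma relations_minus_three:
  assumes "(-3, b) \<in> Lambda_odd"
  shows "mon 1 [Af', Af'] (-3, b) \<in> relations"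
    "mon 1 [Af', Ag'] (-3, b) + mon (- (1 / 16)) [Ag', Af'] (-3, b) \<in> relations"
    "mon 1 [Aq, Af'] (-3, b) + mon (- 4) [Af, Aq] (-3, b) \<in> relations"
proof -
  have "(1, b) \<in> Lambda_odd" using Lambda_odd_flip[OF assms] by simp
  from relations.eq1[OF this refl refl]
  show "mon 1 [Af', Af'] (-3, b) \<in> relations"
    "mon 1 [Af', Ag'] (-3, b) + mon (- (1 / 16)) [Ag', Af'] (-3, b) \<in> relations"
    "mon 1 [Aq, Af'] (-3, b) + mon (- 4) [Af, Aq] (-3, b) \<in> relations"
    unfolding mon_diff_mon[symmetric] by simp_all
qed

lemma relations_minus_one:
  assumes "(-1, b) \<in> Lambda_odd"
  shows "mon 1 [Af', Af'] (-1, b) \<in> relations" "mon 1 [Ag', Af'] (-1, b) \<in> relations"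
  by (auto intro!: relations.eq_minus1[OF assms refl])

lemma arr_anticommute:
  assumes rel: "mon 1 [x, y] \<rho> + mon d [x', y'] \<rho> \<in> relations" and \<rho>: "\<rho> \<in> Lambda_odd"
    and 1: "has_arrow y \<rho>" "arrow_target y \<rho> = \<nu>" "has_arrow x \<nu>" "arrow_target x \<nu> = v"
    and 2: "has_arrow y' \<rho>" "arrow_target y' \<rho> = \<nu>'" "has_arrow x' \<nu>'" "arrow_target x' \<nu>' = v"
    and d: "scal x' \<nu>' * scal y' \<rho> = d * (scal x \<nu> * scal y \<rho>)"
  shows "arr \<nu> v * arr \<rho> \<nu> + arr \<nu>' v * arr \<rho> \<nu>' = 0"
  using relation_scaled[OF rel \<rho>, of "scal x \<nu> * scal y \<rho>"]
  by (simp add: arr_arr[OF 1] arr_arr[OF 2] d)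

text \<open>In terms of end points the squares look alike on both halves of the quiver: the step to
  (a+2, b+1) is f for a \<ge> 1 and g' for a \<le> -3, the step to (a-2, b+1) is g or f', the step
  to (-a-2, b) is p or q. This family pairs f with g and f' with g'; the next two pair these letters
  with p and q.\<close>

lemma arr_square_1:
  assumes "(a, b) \<in> Lambda_odd" "a \<ge> 3 \<or> a \<le> -3"
  shows "arr (a + 2, b + 1) (a, b + 2) * arr (a, b) (a + 2, b + 1)
    + arr (a - 2, b + 1) (a, b + 2) * arr (a, b) (a - 2, b + 1) = 0"
proof -
  have "odd a" using assms by (simp add: Lambda_odd_iff)
  then have "a \<ge> 3 \<or> a \<le> -5 \<or> a = -3" using assms(2) by presburger
  then consider "a \<ge> 3" | "a \<le> -5" | "a = -3" by blast
  then show ?thesis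
  proof cases
    case 1
    show ?thesis unfolding add.commute[of "arr (a + 2, _) _ * _"]
      using 1 by (intro arr_anticommute[OF relations_pos(4)[OF assms(1) 1] assms(1)])
        (auto simp: divide_simps of_int_nonzero power2_eq_square, (simp_all add: algebra_simps)?)
  next
    case 2
    then show ?thesis
      by (intro arr_anticommute[OF relations_neg(3)[OF assms(1) 2] assms(1)])
        (auto simp: divide_simps of_int_nonzero power2_eq_square, (simp_all add: algebra_simps)?)
  next
    case 3
    \<comment> \<open>The special values of \<open>scal\<close> come from this square. The path g'f'
      carries (-1/2)(-1/32) = 1/64, so the relation f'g' - (1/16) g'f' = 0 forces -1/4 for g' at -3
      once f' at -1 is normalised to 1.\<close>
    then show ?thesis using assms(1)
      by (auto intro!: arr_anticommute[OF relations_minus_three(2)] simp: power2_eq_square)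
  qed
qed

lemma arr_square_2:
  assumes "(a, b) \<in> Lambda_odd" "a \<ge> 1 \<or> a \<le> -5"
  shows "arr (- a - 2, b) (- a - 4, b + 1) * arr (a, b) (- a - 2, b)
    + arr (a + 2, b + 1) (- a - 4, b + 1) * arr (a, b) (a + 2, b + 1) = 0"
proof -
  have "odd a" using assms by (simp add: Lambda_odd_iff)
  then have "a \<ge> 3 \<or> a = 1 \<or> a \<le> -5" using assms(2) by presburger
  then consider "a \<ge> 3" | "a = 1" | "a \<le> -5" by blast
  then show ?thesis
  proof cases
    case 1
    then show ?thesis 
      by (intro arr_anticommute[OF relations_pos(5)[OF assms(1) 1] assms(1)])
        (auto simp: divide_simps of_int_nonzero power2_eq_square, (simp_all add: algebra_simps)?)
  next
    case 2
    then show ?thesis using assms(1)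
      by (auto intro!: arr_anticommute[OF relations_one(3)])
  next
    case 3
    show ?thesis unfolding add.commute[of "arr (- a - 2, _) _ * _"]
      using 3 by (intro arr_anticommute[OF relations_neg(5)[OF assms(1) 3] assms(1)])
        (auto simp: divide_simps of_int_nonzero power2_eq_square, (simp_all add: algebra_simps)?)
  qed
qed

lemma arr_square_3:
  assumes "(a, b) \<in> Lambda_odd" "a \<ge> 3 \<or> a \<le> -3"
  shows "arr (- a - 2, b) (- a, b + 1) * arr (a, b) (- a - 2, b)
    + arr (a - 2, b + 1) (- a, b + 1) * arr (a, b) (a - 2, b + 1) = 0"
proof -
  have "odd a" using assms by (simp add: Lambda_odd_iff)
  then have "a \<ge> 3 \<or> a = -3 \<or> a \<le> -5" using assms(2) by presburger
  then consider "a \<ge> 3" | "a = -3" | "a \<le> -5" by blast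
  then show ?thesis
  proof cases
    case 1
    then show ?thesis 
      by (intro arr_anticommute[OF relations_pos(6)[OF assms(1) 1] assms(1)])
        (auto simp: divide_simps of_int_nonzero power2_eq_square, (simp_all add: algebra_simps)?)
  next
    case 2
    show ?thesis unfolding add.commute[of "arr (- a - 2, _) _ * _"]
      using 2 assms(1)
      by (auto intro!: arr_anticommute[OF relations_minus_three(3)])
  next
    case 3
    show ?thesis unfolding add.commute[of "arr (- a - 2, _) _ * _"]
      using 3 by (intro arr_anticommute[OF relations_neg(4)[OF assms(1) 3] assms(1)])
        (auto simp: divide_simps of_int_nonzero power2_eq_square, (simp_all add: algebra_simps)?)
  qed
qed

section \<open>Paths of length two\<close>

lemma arr_arr_eq_0:
  assumes "mon 1 [x, y] \<rho> \<in> relations" "\<rho> \<in> Lambda_odd"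
    "has_arrow y \<rho>" "arrow_target y \<rho> = \<nu>" "has_arrow x \<nu>" "arrow_target x \<nu> = v"
  shows "arr \<nu> v * arr \<rho> \<nu> = 0"
  by (simp add: arr_arr[OF assms(3-6)] relation_scaled_monomial[OF assms(1,2)])

lemma arr_line_1:
  assumes "(a, b) \<in> Lambda_odd" "a \<ge> 1 \<or> a \<le> -5"
  shows "arr (a + 2, b + 1) (a + 4, b + 2) * arr (a, b) (a + 2, b + 1) = 0"
proof -
  have "odd a" using assms by (simp add: Lambda_odd_iff)
  then have "a \<ge> 3 \<or> a = 1 \<or> a \<le> -5" using assms(2) by presburger
  then consider "a \<ge> 3" | "a = 1" | "a \<le> -5" by blast
  then show ?thesis
  proof cases
    case 1
    then show ?thesis by (intro arr_arr_eq_0[OF relations_pos(1)[OF assms(1)] assms(1)]) auto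
  next
    case 2
    then show ?thesis using assms(1) by (intro arr_arr_eq_0[of Af Af]) (auto intro: relations_one)
  next
    case 3
    then show ?thesis by (intro arr_arr_eq_0[OF relations_neg(2)[OF assms(1)] assms(1)]) auto
  qed
qed

lemma arr_line_2:
  assumes "(a, b) \<in> Lambda_odd" "a \<ge> 5 \<or> a \<le> -1"
  shows "arr (a - 2, b + 1) (a - 4, b + 2) * arr (a, b) (a - 2, b + 1) = 0"
proof -
  have "odd a" using assms by (simp add: Lambda_odd_iff)
  then have "a \<ge> 5 \<or> a = -1 \<or> a = -3 \<or> a \<le> -5" using assms(2) by presburger
  then consider "a \<ge> 5" | "a = -1" | "a = -3" | "a \<le> -5" by blast
  then show ?thesis
  proof cases
    case 1
    then show ?thesis by (intro arr_arr_eq_0[OF relations_pos(2)[OF assms(1)] assms(1)]) auto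
  next
    case 2
    then show ?thesis using assms(1)
      by (intro arr_arr_eq_0[of Af' Af']) (auto intro: relations_minus_one)
  next
    case 3
    then show ?thesis using assms(1)
      by (intro arr_arr_eq_0[of Af' Af']) (auto intro: relations_minus_three)
  next
    case 4
    then show ?thesis by (intro arr_arr_eq_0[OF relations_neg(1)[OF assms(1)] assms(1)]) auto
  qed
qed

lemma arr_line_3:
  assumes "(a, b) \<in> Lambda_odd" "a \<ge> 1"
  shows "arr (- a - 2, b) (a, b) * arr (a, b) (- a - 2, b) = 0"
proof -
  have "odd a" using assms by (simp add: Lambda_odd_iff)
  then have "a \<ge> 3 \<or> a = 1" using assms(2) by presburger
  then consider "a \<ge> 3" | "a = 1" by blast
  then show ?thesis
  proof cases
    case 1
    then show ?thesis by (intro arr_arr_eq_0[OF relations_pos(3)[OF assms(1)] assms(1)]) auto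
  next
    case 2
    then show ?thesis using assms(1) by (intro arr_arr_eq_0[of Aq Ap]) (auto intro: relations_one)
  qed
qed

lemma arr_line_4:
  assumes "(-1, b) \<in> Lambda_odd"
  shows "arr (-3, b + 1) (-1, b + 2) * arr (-1, b) (-3, b + 1) = 0"
  using assms by (intro arr_arr_eq_0[of Ag' Af']) (auto intro: relations_minus_one)

text \<open>Near (a, b) the quiver has one of six shapes, for a \<ge> 5, a = 3, 1, -1, -3 and a
  \<le> -5, and in each the paths of length two can be listed. Of the eleven outcomes the first
  three are anticommuting squares, the next four zero relations, the last four free paths; no pair
  has more than two middle vertices.\<close>

lemma mids_cases:
  assumes "(a, b) \<in> Lambda_odd" "mids (a, b) v \<noteq> {}"
  obtains
    "a \<ge> 3 \<or> a \<le> -3" "v = (a, b + 2)" "mids (a, b) v = {(a + 2, b + 1), (a - 2, b + 1)}"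
      "\<not> free_pair (a, b) v"
  | "a \<ge> 1 \<or> a \<le> -5" "v = (- a - 4, b + 1)" "mids (a, b) v = {(- a - 2, b), (a + 2, b + 1)}"
      "\<not> free_pair (a, b) v"
  | "a \<ge> 3 \<or> a \<le> -3" "v = (- a, b + 1)" "mids (a, b) v = {(- a - 2, b), (a - 2, b + 1)}"
      "\<not> free_pair (a, b) v"
  | "a \<ge> 1 \<or> a \<le> -5" "v = (a + 4, b + 2)" "mids (a, b) v = {(a + 2, b + 1)}"
      "\<not> free_pair (a, b) v"
  | "a \<ge> 5 \<or> a \<le> -1" "v = (a - 4, b + 2)" "mids (a, b) v = {(a - 2, b + 1)}"
      "\<not> free_pair (a, b) v"
  | "a \<ge> 1" "v = (a, b)" "mids (a, b) v = {(- a - 2, b)}" "\<not> free_pair (a, b) v"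
  | "a = -1" "v = (-1, b + 2)" "mids (a, b) v = {(-3, b + 1)}" "\<not> free_pair (a, b) v"
  | "a = 1" "v = (1, b + 2)" "mids (a, b) v = {(3, b + 1)}" "free_pair (a, b) v"
  | "a = 1" "v = (-1, b + 1)" "mids (a, b) v = {(-3, b)}" "free_pair (a, b) v"
  | "a = -1" "v = (1, b + 1)" "mids (a, b) v = {(-3, b + 1)}" "free_pair (a, b) v"
  | "a \<le> -3" "v = (a, b)" "mids (a, b) v = {(- a - 2, b)}" "free_pair (a, b) v"
proof -
  have a: "odd a" using assms(1) by (simp add: Lambda_odd_iff)
  have "a \<ge> 5 \<or> a = 3 \<or> a = 1 \<or> a = -1 \<or> a = -3 \<or> a \<le> -5" using a by presburger
  then consider "a \<ge> 5" | "a = 3" | "a \<le> -5" | "a = -3" | "a = 1" | "a = -1" by blast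
  then show thesis
  proof cases
    case 1
    have s: "edge (a, b) \<nu> \<longleftrightarrow> \<nu> = (a + 2, b + 1) \<or> \<nu> = (a - 2, b + 1) \<or> \<nu> = (- a - 2, b)" for \<nu>
      using 1 by (auto simp: edge_iff)
    have t0: "edge (a + 2, b + 1) u \<longleftrightarrow> u = (a + 4, b + 2) \<or> u = (a, b + 2) \<or> u = (- a - 4, b + 1)" for u
      using 1 by (auto simp: edge_iff)
    have t1: "edge (a - 2, b + 1) u \<longleftrightarrow> u = (a, b + 2) \<or> u = (- a, b + 1) \<or> u = (a - 4, b + 2)" for u
      using 1 by (auto simp: edge_iff)
    have t2: "edge (- a - 2, b) u \<longleftrightarrow> u = (- a - 4, b + 1) \<or> u = (- a, b + 1) \<or> u = (a, b)" for u
      using 1 by (auto simp: edge_iff)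
    from assms(2) have "v = (a + 4, b + 2) \<or> v = (a, b + 2) \<or> v = (- a - 4, b + 1) \<or> v = (- a, b + 1) \<or> v = (a - 4, b + 2) \<or> v = (a, b)"
      by (auto simp: mids_def s t0 t1 t2)
    then show thesis
    proof (elim disjE)
      assume v: "v = (a + 4, b + 2)"
      have "mids (a, b) v = {(a + 2, b + 1)}"
        unfolding mids_def using v by (auto simp: s t0 t1 t2)
      then show thesis using v 1 by (intro that(4)) (auto simp: free_pair_def)
    next
      assume v: "v = (a, b + 2)"
      have "mids (a, b) v = {(a + 2, b + 1), (a - 2, b + 1)}"
        unfolding mids_def using v by (auto simp: s t0 t1 t2)
      then show thesis using v 1 by (intro that(1)) (auto simp: free_pair_def)
    next
      assume v: "v = (- a - 4, b + 1)"
      have "mids (a, b) v = {(a + 2, b + 1), (- a - 2, b)}"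
        unfolding mids_def using v by (auto simp: s t0 t1 t2)
      then show thesis using v 1 by (intro that(2)) (auto simp: free_pair_def)
    next
      assume v: "v = (- a, b + 1)"
      have "mids (a, b) v = {(a - 2, b + 1), (- a - 2, b)}"
        unfolding mids_def using v by (auto simp: s t0 t1 t2)
      then show thesis using v 1 by (intro that(3)) (auto simp: free_pair_def)
    next
      assume v: "v = (a - 4, b + 2)"
      have "mids (a, b) v = {(a - 2, b + 1)}"
        unfolding mids_def using v by (auto simp: s t0 t1 t2)
      then show thesis using v 1 by (intro that(5)) (auto simp: free_pair_def)
    next
      assume v: "v = (a, b)"
      have "mids (a, b) v = {(- a - 2, b)}"
        unfolding mids_def using v by (auto simp: s t0 t1 t2)
      then show thesis using v 1 by (intro that(6)) (auto simp: free_pair_def)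
    qed
  next
    case 2
    have s: "edge (a, b) \<nu> \<longleftrightarrow> \<nu> = (a + 2, b + 1) \<or> \<nu> = (a - 2, b + 1) \<or> \<nu> = (- a - 2, b)" for \<nu>
      using 2 by (auto simp: edge_iff)
    have t0: "edge (a + 2, b + 1) u \<longleftrightarrow> u = (a + 4, b + 2) \<or> u = (a, b + 2) \<or> u = (- a - 4, b + 1)" for u
      using 2 by (auto simp: edge_iff)
    have t1: "edge (a - 2, b + 1) u \<longleftrightarrow> u = (a, b + 2) \<or> u = (- a, b + 1)" for u
      using 2 by (auto simp: edge_iff)
    have t2: "edge (- a - 2, b) u \<longleftrightarrow> u = (- a - 4, b + 1) \<or> u = (- a, b + 1) \<or> u = (a, b)" for u
      using 2 by (auto simp: edge_iff)
    from assms(2) have "v = (a + 4, b + 2) \<or> v = (a, b + 2) \<or> v = (- a - 4, b + 1) \<or> v = (- a, b + 1) \<or> v = (a, b)"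
      by (auto simp: mids_def s t0 t1 t2)
    then show thesis
    proof (elim disjE)
      assume v: "v = (a + 4, b + 2)"
      have "mids (a, b) v = {(a + 2, b + 1)}"
        unfolding mids_def using v by (auto simp: s t0 t1 t2)
      then show thesis using v 2 by (intro that(4)) (auto simp: free_pair_def)
    next
      assume v: "v = (a, b + 2)"
      have "mids (a, b) v = {(a + 2, b + 1), (a - 2, b + 1)}"
        unfolding mids_def using v by (auto simp: s t0 t1 t2)
      then show thesis using v 2 by (intro that(1)) (auto simp: free_pair_def)
    next
      assume v: "v = (- a - 4, b + 1)"
      have "mids (a, b) v = {(a + 2, b + 1), (- a - 2, b)}"
        unfolding mids_def using v by (auto simp: s t0 t1 t2)
      then show thesis using v 2 by (intro that(2)) (auto simp: free_pair_def)
    next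
      assume v: "v = (- a, b + 1)"
      have "mids (a, b) v = {(a - 2, b + 1), (- a - 2, b)}"
        unfolding mids_def using v by (auto simp: s t0 t1 t2)
      then show thesis using v 2 by (intro that(3)) (auto simp: free_pair_def)
    next
      assume v: "v = (a, b)"
      have "mids (a, b) v = {(- a - 2, b)}"
        unfolding mids_def using v by (auto simp: s t0 t1 t2)
      then show thesis using v 2 by (intro that(6)) (auto simp: free_pair_def)
    qed
  next
    case 3
    have s: "edge (a, b) \<nu> \<longleftrightarrow> \<nu> = (a + 2, b + 1) \<or> \<nu> = (a - 2, b + 1) \<or> \<nu> = (- a - 2, b)" for \<nu>
      using 3 by (auto simp: edge_iff)
    have t0: "edge (a + 2, b + 1) u \<longleftrightarrow> u = (a + 4, b + 2) \<or> u = (a, b + 2) \<or> u = (- a - 4, b + 1)" for u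
      using 3 by (auto simp: edge_iff)
    have t1: "edge (a - 2, b + 1) u \<longleftrightarrow> u = (a, b + 2) \<or> u = (- a, b + 1) \<or> u = (a - 4, b + 2)" for u
      using 3 by (auto simp: edge_iff)
    have t2: "edge (- a - 2, b) u \<longleftrightarrow> u = (- a - 4, b + 1) \<or> u = (- a, b + 1) \<or> u = (a, b)" for u
      using 3 by (auto simp: edge_iff)
    from assms(2) have "v = (a + 4, b + 2) \<or> v = (a, b + 2) \<or> v = (- a - 4, b + 1) \<or> v = (- a, b + 1) \<or> v = (a - 4, b + 2) \<or> v = (a, b)"
      by (auto simp: mids_def s t0 t1 t2)
    then show thesis
    proof (elim disjE)
      assume v: "v = (a + 4, b + 2)"
      have "mids (a, b) v = {(a + 2, b + 1)}"
        unfolding mids_def using v by (auto simp: s t0 t1 t2)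
      then show thesis using v 3 by (intro that(4)) (auto simp: free_pair_def)
    next
      assume v: "v = (a, b + 2)"
      have "mids (a, b) v = {(a + 2, b + 1), (a - 2, b + 1)}"
        unfolding mids_def using v by (auto simp: s t0 t1 t2)
      then show thesis using v 3 by (intro that(1)) (auto simp: free_pair_def)
    next
      assume v: "v = (- a - 4, b + 1)"
      have "mids (a, b) v = {(a + 2, b + 1), (- a - 2, b)}"
        unfolding mids_def using v by (auto simp: s t0 t1 t2)
      then show thesis using v 3 by (intro that(2)) (auto simp: free_pair_def)
    next
      assume v: "v = (- a, b + 1)"
      have "mids (a, b) v = {(a - 2, b + 1), (- a - 2, b)}"
        unfolding mids_def using v by (auto simp: s t0 t1 t2)
      then show thesis using v 3 by (intro that(3)) (auto simp: free_pair_def)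
    next
      assume v: "v = (a - 4, b + 2)"
      have "mids (a, b) v = {(a - 2, b + 1)}"
        unfolding mids_def using v by (auto simp: s t0 t1 t2)
      then show thesis using v 3 by (intro that(5)) (auto simp: free_pair_def)
    next
      assume v: "v = (a, b)"
      have "mids (a, b) v = {(- a - 2, b)}"
        unfolding mids_def using v by (auto simp: s t0 t1 t2)
      then show thesis using v 3 by (intro that(11)) (auto simp: free_pair_def)
    qed
  next
    case 4
    have s: "edge (a, b) \<nu> \<longleftrightarrow> \<nu> = (a + 2, b + 1) \<or> \<nu> = (a - 2, b + 1) \<or> \<nu> = (- a - 2, b)" for \<nu>
      using 4 by (auto simp: edge_iff)
    have t0: "edge (a + 2, b + 1) u \<longleftrightarrow> u = (a, b + 2)" for u
      using 4 by (auto simp: edge_iff)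
    have t1: "edge (a - 2, b + 1) u \<longleftrightarrow> u = (a - 4, b + 2) \<or> u = (a, b + 2) \<or> u = (- a, b + 1)" for u
      using 4 by (auto simp: edge_iff)
    have t2: "edge (- a - 2, b) u \<longleftrightarrow> u = (- a, b + 1) \<or> u = (a, b)" for u
      using 4 by (auto simp: edge_iff)
    from assms(2) have "v = (a, b + 2) \<or> v = (a - 4, b + 2) \<or> v = (- a, b + 1) \<or> v = (a, b)"
      by (auto simp: mids_def s t0 t1 t2)
    then show thesis
    proof (elim disjE)
      assume v: "v = (a, b + 2)"
      have "mids (a, b) v = {(a + 2, b + 1), (a - 2, b + 1)}"
        unfolding mids_def using v by (auto simp: s t0 t1 t2)
      then show thesis using v 4 by (intro that(1)) (auto simp: free_pair_def)
    next
      assume v: "v = (a - 4, b + 2)"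
      have "mids (a, b) v = {(a - 2, b + 1)}"
        unfolding mids_def using v by (auto simp: s t0 t1 t2)
      then show thesis using v 4 by (intro that(5)) (auto simp: free_pair_def)
    next
      assume v: "v = (- a, b + 1)"
      have "mids (a, b) v = {(a - 2, b + 1), (- a - 2, b)}"
        unfolding mids_def using v by (auto simp: s t0 t1 t2)
      then show thesis using v 4 by (intro that(3)) (auto simp: free_pair_def)
    next
      assume v: "v = (a, b)"
      have "mids (a, b) v = {(- a - 2, b)}"
        unfolding mids_def using v by (auto simp: s t0 t1 t2)
      then show thesis using v 4 by (intro that(11)) (auto simp: free_pair_def)
    qed
  next
    case 5
    have s: "edge (a, b) \<nu> \<longleftrightarrow> \<nu> = (a + 2, b + 1) \<or> \<nu> = (- a - 2, b)" for \<nu>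
      using 5 by (auto simp: edge_iff)
    have t0: "edge (a + 2, b + 1) u \<longleftrightarrow> u = (a + 4, b + 2) \<or> u = (a, b + 2) \<or> u = (- a - 4, b + 1)" for u
      using 5 by (auto simp: edge_iff)
    have t1: "edge (- a - 2, b) u \<longleftrightarrow> u = (- a - 4, b + 1) \<or> u = (- a, b + 1) \<or> u = (a, b)" for u
      using 5 by (auto simp: edge_iff)
    from assms(2) have "v = (a + 4, b + 2) \<or> v = (a, b + 2) \<or> v = (- a - 4, b + 1) \<or> v = (- a, b + 1) \<or> v = (a, b)"
      by (auto simp: mids_def s t0 t1)
    then show thesis
    proof (elim disjE)
      assume v: "v = (a + 4, b + 2)"
      have "mids (a, b) v = {(a + 2, b + 1)}"
        unfolding mids_def using v by (auto simp: s t0 t1)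
      then show thesis using v 5 by (intro that(4)) (auto simp: free_pair_def)
    next
      assume v: "v = (a, b + 2)"
      have "mids (a, b) v = {(a + 2, b + 1)}"
        unfolding mids_def using v by (auto simp: s t0 t1)
      then show thesis using v 5 by (intro that(8)) (auto simp: free_pair_def)
    next
      assume v: "v = (- a - 4, b + 1)"
      have "mids (a, b) v = {(a + 2, b + 1), (- a - 2, b)}"
        unfolding mids_def using v by (auto simp: s t0 t1)
      then show thesis using v 5 by (intro that(2)) (auto simp: free_pair_def)
    next
      assume v: "v = (- a, b + 1)"
      have "mids (a, b) v = {(- a - 2, b)}"
        unfolding mids_def using v by (auto simp: s t0 t1)
      then show thesis using v 5 by (intro that(9)) (auto simp: free_pair_def)
    next
      assume v: "v = (a, b)"
      have "mids (a, b) v = {(- a - 2, b)}"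
        unfolding mids_def using v by (auto simp: s t0 t1)
      then show thesis using v 5 by (intro that(6)) (auto simp: free_pair_def)
    qed
  next
    case 6
    have s: "edge (a, b) \<nu> \<longleftrightarrow> \<nu> = (a - 2, b + 1)" for \<nu>
      using 6 by (auto simp: edge_iff)
    have t0: "edge (a - 2, b + 1) u \<longleftrightarrow> u = (a - 4, b + 2) \<or> u = (a, b + 2) \<or> u = (- a, b + 1)" for u
      using 6 by (auto simp: edge_iff)
    from assms(2) have "v = (a - 4, b + 2) \<or> v = (a, b + 2) \<or> v = (- a, b + 1)"
      by (auto simp: mids_def s t0)
    then show thesis
    proof (elim disjE)
      assume v: "v = (a - 4, b + 2)"
      have "mids (a, b) v = {(a - 2, b + 1)}"
        unfolding mids_def using v by (auto simp: s t0)
      then show thesis using v 6 by (intro that(5)) (auto simp: free_pair_def)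
    next
      assume v: "v = (a, b + 2)"
      have "mids (a, b) v = {(a - 2, b + 1)}"
        unfolding mids_def using v by (auto simp: s t0)
      then show thesis using v 6 by (intro that(7)) (auto simp: free_pair_def)
    next
      assume v: "v = (- a, b + 1)"
      have "mids (a, b) v = {(a - 2, b + 1)}"
        unfolding mids_def using v by (auto simp: s t0)
      then show thesis using v 6 by (intro that(10)) (auto simp: free_pair_def)
    qed
  qed
qed

lemma sum_mids_eq_0:
  assumes "\<rho> \<in> Lambda_odd" "\<not> free_pair \<rho> v"
  shows "(\<Sum>\<nu>\<in>mids \<rho> v. arr \<nu> v * arr \<rho> \<nu>) = 0"
proof (cases "mids \<rho> v = {}")
  case False
  obtain a b where \<rho>: "\<rho> = (a, b)" by fastforce
  note h = assms(1)[unfolded \<rho>]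
  from h False[unfolded \<rho>] show ?thesis
  proof (cases rule: mids_cases)
    case 1
    then show ?thesis using arr_square_1[OF h] by (simp add: \<rho>)
  next
    case 2
    then show ?thesis using arr_square_2[OF h] by (simp add: \<rho>)
  next
    case 3
    then show ?thesis using arr_square_3[OF h] by (simp add: \<rho>)
  next
    case 4
    then show ?thesis using arr_line_1[OF h] by (simp add: \<rho>)
  next
    case 5
    then show ?thesis using arr_line_2[OF h] by (simp add: \<rho>)
  next
    case 6
    then show ?thesis using arr_line_3[OF h] by (simp add: \<rho>)
  next
    case 7
    then show ?thesis using arr_line_4 h by (simp add: \<rho>)
  qed (use assms \<rho> in auto)
qed simp

section \<open>Linear functionals detecting elements of degree two\<close>

definition lin :: "(path \<Rightarrow> complex) \<Rightarrow> path_alg \<Rightarrow> complex" where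
  "lin \<tau> X = (\<Sum>p\<in>Poly_Mapping.keys X. Poly_Mapping.lookup X p * \<tau> p)"

lemma lin_superset:
  assumes "finite K" "Poly_Mapping.keys X \<subseteq> K"
  shows "lin \<tau> X = (\<Sum>p\<in>K. Poly_Mapping.lookup X p * \<tau> p)"
  unfolding lin_def using assms by (intro sum.mono_neutral_left) (auto simp: in_keys_iff)

lemma lin_0 [simp]: "lin \<tau> 0 = 0"
  by (simp add: lin_def)

lemma lin_add: "lin \<tau> (X + Y) = lin \<tau> X + lin \<tau> Y"
  using Poly_Mapping.keys_add[of X Y]
  by (subst (1 2 3) lin_superset[of "Poly_Mapping.keys X \<union> Poly_Mapping.keys Y"])
     (auto simp: lookup_add algebra_simps sum.distrib)

lemma lin_diff: "lin \<tau> (X - Y) = lin \<tau> X - lin \<tau> Y"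
  using lin_add[of \<tau> "X - Y" Y] by simp

lemma lin_sum: "lin \<tau> (sum f S) = (\<Sum>s\<in>S. lin \<tau> (f s))"
  by (induction S rule: infinite_finite_induct) (simp_all add: lin_add)

lemma lin_single: "lin \<tau> (Poly_Mapping.single p c) = c * \<tau> p"
  by (simp add: lin_def)

lemma lin_mon: "lin \<tau> (mon c w v) = (if is_path w v then c * \<tau> (Abs_path (w, v)) else 0)"
  by (simp add: mon_def lin_single)

lemma lin_path_mult:
  "lin \<tau> (path_mult X Y) = (\<Sum>p\<in>Poly_Mapping.keys X. \<Sum>q\<in>Poly_Mapping.keys Y.
     if source p = target q
     then Poly_Mapping.lookup X p * Poly_Mapping.lookup Y q * \<tau> (comp_path p q) else 0)"
  unfolding path_mult_def lin_sum by (intro sum.cong refl) (simp add: lin_single)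

text \<open>The functional \<open>lin (dual \<rho> v)\<close> vanishes on the ideal of relations, so that
  it separates elements of degree two in \<open>e\<^sub>v\<A>e\<^sub>\<rho>\<close>.\<close>

fun sg :: "arrow \<Rightarrow> arrow \<Rightarrow> weight \<Rightarrow> complex" where
  "sg Af Ag _ = 1" | "sg Ag Af _ = -1"
| "sg Af' Ag' _ = 1" | "sg Ag' Af' (c, b) = (if c = -1 then 0 else -1)"
| "sg Af' Ap _ = 1" | "sg Ap Af _ = -1"
| "sg Ag' Ap _ = 1" | "sg Ap Ag _ = -1"
| "sg Aq Af' _ = 1" | "sg Af Aq _ = -1"
| "sg Aq Ag' _ = 1" | "sg Ag Aq _ = -1"
| "sg Ap Aq _ = 1" | "sg _ _ _ = 0"

fun dual_word :: "arrow list \<Rightarrow> weight \<Rightarrow> complex" where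
  "dual_word [x, y] \<rho> = sg x y \<rho> / (scal x (arrow_target y \<rho>) * scal y \<rho>)"
| "dual_word _ \<rho> = 0"

definition dual :: "weight \<Rightarrow> weight \<Rightarrow> path \<Rightarrow> complex" where
  "dual \<rho> v p = (if source p = \<rho> \<and> target p = v then dual_word (word p) \<rho> else 0)"

lemma dual_word_length: "length w \<noteq> 2 \<Longrightarrow> dual_word w \<rho> = 0"
  by (cases "(w, \<rho>)" rule: dual_word.cases) auto

lemma lin_dual_mon:
  "lin (dual \<rho> v) (mon c w s) =
    (if is_path w s \<and> s = \<rho> \<and> end_of w s = v then c * dual_word w s else 0)"
  by (auto simp: lin_mon dual_def source_Abs word_Abs target_def)

text \<open>On a square the two signs of \<open>sg\<close> are opposite, and dividing by
  \<open>scal\<close> absorbs the coefficient of the relation; a word that is itself a relation has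
  sign 0. The sign of g'f' depends on the source, because this word is a side of a square for c
  \<le> -3 but a zero relation at c = -1.\<close>

lemma lin_dual_relations:
  assumes "X \<in> relations"
  shows "lin (dual \<rho> v) X = 0"
  using assms
proof cases
  case (ge3 a b s s')
  show ?thesis using ge3(2,5) unfolding ge3(3,4)
    by (elim insertE emptyE)
       (auto simp: lin_add lin_diff lin_dual_mon divide_simps of_int_nonzero power2_eq_square,
        (simp_all add: algebra_simps)?)
next
  case (eq1 b s s')
  then show ?thesis
    by (elim insertE emptyE) (auto simp: lin_add lin_diff lin_dual_mon)
next
  case (eq_minus1 b s')
  then show ?thesis
    by (elim insertE emptyE) (auto simp: lin_add lin_diff lin_dual_mon)
qed

lemma dual_comp_path:
  assumes "source p = target q" "plen p \<noteq> 0" "plen q \<ge> 2"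
  shows "dual \<rho> v (comp_path p q) = 0"
  using assms by (auto simp: dual_def comp_path_simps intro!: dual_word_length) (auto simp: plen_def neq_Nil_conv)

lemma comp_path_trivial_left:
  assumes "source p = target q" "plen p = 0"
  shows "comp_path p q = q"
  using assms by (simp add: comp_path_def plen_def word_def source_def rep_path_inverse)

lemma comp_path_trivial_right:
  assumes "source p = target q" "plen q = 0"
  shows "comp_path p q = p"
proof -
  have "source q = source p" using assms by (simp add: target_def plen_def)
  then show ?thesis
    using assms by (simp add: comp_path_def plen_def word_def source_def) (metis prod.collapse rep_path_inverse)
qed

text \<open>Since \<open>X\<close> has no terms shorter than two, only trivial paths in
  \<open>R\<close> can contribute to length two, and the functional gets multiplied by the
  coefficient of the trivial path at v. Vanishing on \<open>X\<close> thus passes to its multiples,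
  as the induction over the ideal requires.\<close>

lemma lin_dual_mult_left:
  assumes "\<And>p. plen p < 2 \<Longrightarrow> Poly_Mapping.lookup X p = 0"
  shows "lin (dual \<rho> v) (path_mult R X) =
    (\<Sum>p | p \<in> Poly_Mapping.keys R \<and> plen p = 0 \<and> source p = v. Poly_Mapping.lookup R p)
      * lin (dual \<rho> v) X"
proof -
  have "lin (dual \<rho> v) (path_mult R X) = (\<Sum>p\<in>Poly_Mapping.keys R. \<Sum>q\<in>Poly_Mapping.keys X.
     (if plen p = 0 \<and> source p = v then Poly_Mapping.lookup R p else 0) *
     (Poly_Mapping.lookup X q * dual \<rho> v q))"
    unfolding lin_path_mult
  proof (intro sum.cong refl)
    fix p q assume q: "q \<in> Poly_Mapping.keys X"
    then have "plen q \<ge> 2" using assms by (metis in_keys_iff not_less)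
    then show "(if source p = target q
          then Poly_Mapping.lookup R p * Poly_Mapping.lookup X q * dual \<rho> v (comp_path p q) else 0) =
        (if plen p = 0 \<and> source p = v then Poly_Mapping.lookup R p else 0) *
          (Poly_Mapping.lookup X q * dual \<rho> v q)"
      by (cases "plen p = 0")
         (auto simp: comp_path_trivial_left dual_comp_path, auto simp: dual_def)
  qed
  also have "\<dots> = (\<Sum>p\<in>Poly_Mapping.keys R. 
     (if plen p = 0 \<and> source p = v then Poly_Mapping.lookup R p else 0)) * lin (dual \<rho> v) X"
    by (simp add: lin_def sum_product)
  finally show ?thesis by (simp add: sum.inter_filter)
qed

lemma lin_dual_mult_right:
  assumes "\<And>p. plen p < 2 \<Longrightarrow> Poly_Mapping.lookup X p = 0"
  shows "lin (dual \<rho> v) (path_mult X R) =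
    lin (dual \<rho> v) X * 
    (\<Sum>p | p \<in> Poly_Mapping.keys R \<and> plen p = 0 \<and> source p = \<rho>. Poly_Mapping.lookup R p)"
proof -
  have "lin (dual \<rho> v) (path_mult X R) = (\<Sum>q\<in>Poly_Mapping.keys X. \<Sum>p\<in>Poly_Mapping.keys R. 
     (Poly_Mapping.lookup X q * dual \<rho> v q) *
     (if plen p = 0 \<and> source p = \<rho> then Poly_Mapping.lookup R p else 0))"
    unfolding lin_path_mult
  proof (intro sum.cong refl)
    fix p q assume q: "q \<in> Poly_Mapping.keys X"
    then have q2: "plen q \<ge> 2" using assms by (metis in_keys_iff not_less)
    show "(if source q = target p
          then Poly_Mapping.lookup X q * Poly_Mapping.lookup R p * dual \<rho> v (comp_path q p) else 0) =
        (Poly_Mapping.lookup X q * dual \<rho> v q) *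
        (if plen p = 0 \<and> source p = \<rho> then Poly_Mapping.lookup R p else 0)"
    proof (cases "plen p = 0")
      case True
      then have "target p = source p" by (simp add: target_def plen_def)
      then show ?thesis using True
        by (auto simp: comp_path_trivial_right, auto simp: dual_def)
    next
      case False
      with q2 show ?thesis
        by (auto simp: dual_def comp_path_simps intro!: dual_word_length) (auto simp: plen_def neq_Nil_conv)
    qed
  qed
  also have "\<dots> = lin (dual \<rho> v) X * (\<Sum>p\<in>Poly_Mapping.keys R. 
     (if plen p = 0 \<and> source p = \<rho> then Poly_Mapping.lookup R p else 0))"
    by (simp add: lin_def sum_product)
  finally show ?thesis by (simp add: sum.inter_filter)
qed

lemma lin_dual_rel_ideal: "X \<in> rel_ideal \<Longrightarrow> lin (dual \<rho> v) X = 0"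
proof (induction rule: rel_ideal.induct)
  case (mult_left x r)
  then show ?case using lin_dual_mult_left[OF rel_ideal_lookup] by simp
next
  case (mult_right x r)
  then show ?case using lin_dual_mult_right[OF rel_ideal_lookup] by simp
qed (simp_all add: lin_diff lin_dual_relations)

lift_definition dual_coeff :: "weight \<Rightarrow> weight \<Rightarrow> alg \<Rightarrow> complex" is
  "\<lambda>\<rho> v. lin (dual \<rho> v)"
  using lin_dual_rel_ideal by (fastforce simp: ideal_cong_def lin_diff)

lemma dual_coeff_add: "dual_coeff \<rho> v (x + y) = dual_coeff \<rho> v x + dual_coeff \<rho> v y"
  by transfer (simp add: lin_add)

lemma dual_coeff_0 [simp]: "dual_coeff \<rho> v 0 = 0"
  by transfer simp

lemma dual_coeff_sum: "dual_coeff \<rho> v (sum f S) = (\<Sum>s\<in>S. dual_coeff \<rho> v (f s))"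
  by (induction S rule: infinite_finite_induct) (simp_all add: dual_coeff_add)

lemma dual_coeff_mon: "dual_coeff \<rho> v (to_alg (mon c w s)) =
    (if is_path w s \<and> s = \<rho> \<and> end_of w s = v then c * dual_word w s else 0)"
  by (simp add: dual_coeff.abs_eq lin_dual_mon)

lemma dual_coeff_arr_arr:
  assumes "\<rho> \<in> Lambda_odd" "\<nu> \<in> mids \<rho> v"
  shows "dual_coeff \<rho> v (scl w v * (arr \<nu> v * arr \<rho> \<nu>)) = w * sg (link \<nu> v) (link \<rho> \<nu>) \<rho>"
proof -
  have e: "has_arrow (link \<rho> \<nu>) \<rho>" "arrow_target (link \<rho> \<nu>) \<rho> = \<nu>"
    "has_arrow (link \<nu> v) \<nu>" "arrow_target (link \<nu> v) \<nu> = v"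
    using assms(2) by (auto simp: mids_def edge_def)
  show ?thesis
    using e assms(1) scal_nonzero[OF e(1)] scal_nonzero[OF e(3)]
    by (simp add: arr_arr[OF e] scl_mult_mon dual_coeff_mon)
qed

lemma arr_eq_0: "\<not> edge \<nu> v \<Longrightarrow> arr \<nu> v = 0"
  by (simp add: arr_def)

text \<open>The excluded case, a single middle vertex for a pair that is not free, is exactly that
  of a zero relation.\<close>

lemma sg_nonzero:
  assumes "\<rho> \<in> Lambda_odd" "\<nu> \<in> mids \<rho> v" "free_pair \<rho> v \<or> mids \<rho> v \<noteq> {\<nu>}"
  shows "sg (link \<nu> v) (link \<rho> \<nu>) \<rho> \<noteq> 0"
proof -
  obtain a b where \<rho>: "\<rho> = (a, b)" by fastforce
  have h: "(a, b) \<in> Lambda_odd" "mids (a, b) v \<noteq> {}" using assms \<rho> by auto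
  from h show ?thesis
  proof (cases rule: mids_cases)
    case 1
    have "\<nu> = (a + 2, b + 1) \<or> \<nu> = (a - 2, b + 1)"
      using assms(2) unfolding \<rho> 1(3) by simp
    then show ?thesis using 1(1,2) by (elim disjE) (simp_all add: \<rho> link_def)
  next
    case 2
    have "\<nu> = (- a - 2, b) \<or> \<nu> = (a + 2, b + 1)"
      using assms(2) unfolding \<rho> 2(3) by simp
    then show ?thesis using 2(1,2) by (elim disjE) (simp_all add: \<rho> link_def)
  next
    case 3
    have "\<nu> = (- a - 2, b) \<or> \<nu> = (a - 2, b + 1)"
      using assms(2) unfolding \<rho> 3(3) by simp
    then show ?thesis using 3(1,2) by (elim disjE) (simp_all add: \<rho> link_def)
  next
    case 4
    have False using assms(2,3) 4(4) unfolding \<rho> 4(3) by simp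
    then show ?thesis ..
  next
    case 5
    have False using assms(2,3) 5(4) unfolding \<rho> 5(3) by simp
    then show ?thesis ..
  next
    case 6
    have False using assms(2,3) 6(4) unfolding \<rho> 6(3) by simp
    then show ?thesis ..
  next
    case 7
    have False using assms(2,3) 7(4) unfolding \<rho> 7(3) by simp
    then show ?thesis ..
  next
    case 8
    show ?thesis using assms(2) 8(1,2) unfolding \<rho> 8(3) by (simp add: link_def)
  next
    case 9
    show ?thesis using assms(2) 9(1,2) unfolding \<rho> 9(3) by (simp add: link_def)
  next
    case 10
    show ?thesis using assms(2) 10(1,2) unfolding \<rho> 10(3) by (simp add: link_def)
  next
    case 11
    show ?thesis using assms(2) 11(1,2) unfolding \<rho> 11(3) by (simp add: link_def)
  qed
qed

lemma mids_two:
  assumes "\<rho> \<in> Lambda_odd" "\<nu> \<in> mids \<rho> v" "\<nu>' \<in> mids \<rho> v" "\<nu> \<noteq> \<nu>'"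
  shows "mids \<rho> v = {\<nu>, \<nu>'}" "\<not> free_pair \<rho> v"
proof -
  obtain a b where \<rho>: "\<rho> = (a, b)" by fastforce
  have h: "(a, b) \<in> Lambda_odd" "mids (a, b) v \<noteq> {}" using assms \<rho> by auto
  from h have "mids \<rho> v = {\<nu>, \<nu>'} \<and> \<not> free_pair \<rho> v"
    by (cases rule: mids_cases) (use assms(2-4) in \<open>auto simp: \<rho>\<close>)
  then show "mids \<rho> v = {\<nu>, \<nu>'}" "\<not> free_pair \<rho> v" by auto
qed

text \<open>Applying \<open>dual_coeff\<close> leaves the terms over
  \<open>L \<inter> mids \<rho> v\<close>, of which there are at most two. If the pair is free or a
  partner lies outside \<open>L\<close>, a single term with nonzero coefficient remains; two terms
  have opposite coefficients, so their scalars agree.\<close>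

lemma two_step_sum_eq_0:
  assumes \<rho>: "\<rho> \<in> Lambda_odd" and L: "finite L"
    and eq: "(\<Sum>\<nu>\<in>L. scl (w \<nu>) v * (arr \<nu> v * arr \<rho> \<nu>)) = 0"
    and \<nu>: "\<nu> \<in> L" "\<nu> \<in> mids \<rho> v"
  shows "free_pair \<rho> v \<or> \<not> mids \<rho> v \<subseteq> L \<Longrightarrow> w \<nu> = 0"
    and "\<nu>' \<in> L \<Longrightarrow> \<nu>' \<in> mids \<rho> v \<Longrightarrow> w \<nu> = w \<nu>'"
proof -
  define d where "d \<nu> = sg (link \<nu> v) (link \<rho> \<nu>) \<rho>" for \<nu>
  have "0 = (\<Sum>\<nu>\<in>L. dual_coeff \<rho> v (scl (w \<nu>) v * (arr \<nu> v * arr \<rho> \<nu>)))"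
    using eq by (simp flip: dual_coeff_sum)
  also have "\<dots> = (\<Sum>\<nu>\<in>L \<inter> mids \<rho> v. dual_coeff \<rho> v (scl (w \<nu>) v * (arr \<nu> v * arr \<rho> \<nu>)))"
    using L by (intro sum.mono_neutral_right) (auto simp: mids_def, (metis arr_eq_0 dual_coeff_0 mult_zero_left mult_zero_right)+)
  also have "\<dots> = (\<Sum>\<nu>\<in>L \<inter> mids \<rho> v. w \<nu> * d \<nu>)"
    by (intro sum.cong) (auto simp: dual_coeff_arr_arr[OF \<rho>] d_def)
  finally have s: "(\<Sum>\<nu>\<in>L \<inter> mids \<rho> v. w \<nu> * d \<nu>) = 0" by simp
  show "w \<nu> = 0" if "free_pair \<rho> v \<or> \<not> mids \<rho> v \<subseteq> L"
  proof -
    have "L \<inter> mids \<rho> v = {\<nu>}"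
      using that mids_two[OF \<rho> \<nu>(2)] \<nu> by blast
    moreover have "d \<nu> \<noteq> 0"
      unfolding d_def using that \<nu> by (intro sg_nonzero[OF \<rho>]) auto
    ultimately show ?thesis using s by simp
  qed
  show "w \<nu> = w \<nu>'" if \<nu>': "\<nu>' \<in> L" "\<nu>' \<in> mids \<rho> v"
  proof (cases "\<nu> = \<nu>'")
    case False
    note m = mids_two[OF \<rho> \<nu>(2) \<nu>'(2) False]
    have d: "d \<nu> \<noteq> 0" unfolding d_def using False m by (intro sg_nonzero[OF \<rho> \<nu>(2)]) auto
    \<comment> \<open>The coefficients of the two paths are opposite because the functional kills
      their sum, which is zero in the algebra.\<close>
    have "(\<Sum>\<nu>\<in>mids \<rho> v. scl 1 v * (arr \<nu> v * arr \<rho> \<nu>)) = 0"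
      using sum_mids_eq_0[OF \<rho> m(2)] by (simp flip: mult.assoc add: scl_arr)
    then have "0 = dual_coeff \<rho> v (\<Sum>\<nu>\<in>mids \<rho> v. scl 1 v * (arr \<nu> v * arr \<rho> \<nu>))" by simp
    also have "\<dots> = (\<Sum>\<nu>\<in>mids \<rho> v. d \<nu>)"
      unfolding dual_coeff_sum by (intro sum.cong) (auto simp: dual_coeff_arr_arr[OF \<rho>] d_def)
    finally have "d \<nu>' = - d \<nu>" using m False by (simp add: add_eq_0_iff)
    moreover have "L \<inter> mids \<rho> v = {\<nu>, \<nu>'}" using m \<nu> \<nu>' by auto
    ultimately have "(w \<nu> - w \<nu>') * d \<nu> = 0" using s False by (simp add: algebra_simps)
    with d show ?thesis by simp
  qed simp
qed

section \<open>Graded modules\<close>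

text \<open>Elements of the ideal have no terms shorter than two, which makes this well defined.
  Longer paths get 0, since their coefficients have no meaning in the quotient.\<close>

lift_definition coeff :: "path \<Rightarrow> alg \<Rightarrow> complex" is
  "\<lambda>p X. if plen p < 2 then Poly_Mapping.lookup X p else 0"
  using rel_ideal_lookup by (fastforce simp: ideal_cong_def lookup_minus)

lemma coeff_diff: "coeff p (x - y) = coeff p x - coeff p y"
  by transfer (simp add: lookup_minus)

lemma coeff_0 [simp]: "coeff p 0 = 0"
  by transfer simp

lemma coeff_mon:
  assumes "is_path w v" "length w < 2"
  shows "coeff (Abs_path (w, v)) (to_alg (mon c w v)) = c"
  using assms by (simp add: coeff.abs_eq plen_def word_Abs mon_def)

lemma coeff_alg_degree:
  assumes "x \<in> alg_degree i" "int (plen p) \<noteq> i"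
  shows "coeff p x = 0"
  using assms by (fastforce simp: alg_degree_def coeff.abs_eq in_keys_iff)

text \<open>If \<open>x\<close> has no part of degree zero, a path of length one in
  \<open>r * x\<close> arises only from a trivial path in \<open>r\<close> and the same path in
  \<open>x\<close>. These vanishing conditions therefore cut out submodules, one of which will
  exhibit a missing generator.\<close>

lemma coeff_mult_left:
  assumes x0: "\<And>q. plen q = 0 \<Longrightarrow> coeff q x = 0" and p: "plen p = 0 \<or> coeff p x = 0"
  shows "coeff p (r * x) = 0"
proof -
  obtain X where X: "x = to_alg X" by (rule to_alg_cases)
  obtain R where R: "r = to_alg R" by (rule to_alg_cases)
  have x0': "Poly_Mapping.lookup X q = 0" if "plen q = 0" for q
    using x0[OF that] that by (simp add: X coeff.abs_eq)
  show ?thesis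
  proof (cases "plen p < 2")
    case True
    have "Poly_Mapping.lookup (path_mult R X) p = 0"
    proof (rule ccontr)
      assume "\<not> ?thesis"
      from lookup_path_mult_nonzero[OF this] obtain q q' where
        q: "q' \<in> Poly_Mapping.keys X" "source q = target q'" "p = comp_path q q'" by blast
      have "plen q' \<noteq> 0" using x0' q(1) by (auto simp: in_keys_iff)
      then have "plen q = 0" "plen p \<noteq> 0" using q True by (auto simp: comp_path_simps)
      then have "p = q'" "coeff p x = 0" using q p by (auto simp: comp_path_trivial_left)
      then show False using q(1) True by (simp add: X coeff.abs_eq in_keys_iff)
    qed
    then show ?thesis by (simp add: R X to_alg_mult coeff.abs_eq)
  next
    case False
    then show ?thesis by transfer simp
  qed
qed

lemma coeff_other_target:
  assumes "scl 1 u * x = x" "target p \<noteq> u"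
  shows "coeff p x = 0"
proof -
  obtain X where X: "x = to_alg X" by (rule to_alg_cases)
  have "Poly_Mapping.lookup (path_mult (mon 1 [] u) X) p = 0"
  proof (rule ccontr)
    assume "\<not> ?thesis"
    from lookup_path_mult_nonzero[OF this] obtain q q' where
      q: "q \<in> Poly_Mapping.keys (mon 1 [] u)" "source q = target q'" "p = comp_path q q'" by blast
    then have "target q = u"
      by (auto simp: mon_def target_def word_Abs source_Abs split: if_splits)
    with q(2,3) assms(2) show False by (simp add: comp_path_simps)
  qed
  then have "coeff p (scl 1 u * x) = 0"
    by (simp add: X scl_def to_alg_mult coeff.abs_eq)
  with assms(1) show ?thesis by simp
qed

lemma scl_eq_0: "v \<in> Lambda_odd \<Longrightarrow> scl c v = 0 \<longleftrightarrow> c = 0"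
  using coeff_mon[of "[]" v c] by (auto simp: scl_def)

definition arr_path :: "weight \<Rightarrow> weight \<Rightarrow> path" where
  "arr_path \<nu> v = Abs_path ([link \<nu> v], \<nu>)"

lemma arr_path:
  assumes "edge \<nu> v" "\<nu> \<in> Lambda_odd"
  shows "plen (arr_path \<nu> v) = 1" "target (arr_path \<nu> v) = v"
    "coeff (arr_path \<nu> v) (scl c v * arr \<nu> v) = c * scal (link \<nu> v) \<nu>"
  using assms coeff_mon[of "[link \<nu> v]" \<nu>]
  by (auto simp: arr_path_def plen_def word_Abs target_def source_Abs edge_def arr_def scl_mult_mon)

section \<open>Elements of degree at most one between two fixed vertices\<close>

lemma scl_mult_left: "scl c v * (scl d v * x) = scl (c * d) v * x"
  by (simp add: scl_mult flip: mult.assoc)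

lemma sum_scl_mult:
  assumes "\<And>s. s \<in> S \<Longrightarrow> \<exists>c. f s = scl c v * y"
  shows "\<exists>c. sum f S = scl c v * y"
  using assms
proof (induction S rule: infinite_finite_induct)
  case (insert s S)
  then obtain c d where "f s = scl c v * y" "sum f S = scl d v * y" by (metis insertI1 insertI2)
  with insert(1,2) have "sum f (insert s S) = scl (c + d) v * y"
    by (simp add: scl_add algebra_simps)
  then show ?case ..
qed (auto intro: exI[of _ 0])

lemma alg_cut:
  "scl 1 v * to_alg X * scl 1 \<nu> =
    (\<Sum>p\<in>Poly_Mapping.keys X. if target p = v \<and> source p = \<nu>
       then to_alg (mon (Poly_Mapping.lookup X p) (word p) \<nu>) else 0)"
proof -
  have X: "X = (\<Sum>p\<in>Poly_Mapping.keys X. mon (Poly_Mapping.lookup X p) (word p) (source p))"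
  proof (rule poly_mapping_eqI)
    fix q
    have "mon (Poly_Mapping.lookup X p) (word p) (source p) =
        Poly_Mapping.single p (Poly_Mapping.lookup X p)" for p
      by (simp add: mon_def is_path_rep) (simp add: word_def source_def rep_path_inverse)
    then show "Poly_Mapping.lookup X q = Poly_Mapping.lookup
        (\<Sum>p\<in>Poly_Mapping.keys X. mon (Poly_Mapping.lookup X p) (word p) (source p)) q"
      by (simp add: lookup_sum lookup_single when_def sum.delta in_keys_iff)
  qed
  have "scl 1 v * to_alg X * scl 1 \<nu> = (\<Sum>p\<in>Poly_Mapping.keys X.
      scl 1 v * to_alg (mon (Poly_Mapping.lookup X p) (word p) (source p)) * scl 1 \<nu>)"
    by (subst X) (simp add: to_alg_sum sum_distrib_left sum_distrib_right)
  also have "\<dots> = (\<Sum>p\<in>Poly_Mapping.keys X. if target p = v \<and> source p = \<nu>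
       then to_alg (mon (Poly_Mapping.lookup X p) (word p) \<nu>) else 0)"
    by (intro sum.cong refl) (auto simp: scl_mult_mon mon_mult_scl target_def)
  finally show ?thesis .
qed

lemma alg_degree_0:
  assumes "x \<in> alg_degree 0" "scl 1 v * x = x" "x * scl 1 \<nu> = x"
  shows "\<exists>c. x = scl c v" "v \<noteq> \<nu> \<Longrightarrow> x = 0"
proof -
  obtain X where X: "x = to_alg X" "\<forall>p\<in>Poly_Mapping.keys X. plen p = 0"
    using assms(1) by (auto simp: alg_degree_def)
  have x: "x = (\<Sum>p\<in>Poly_Mapping.keys X. if target p = v \<and> source p = \<nu>
       then to_alg (mon (Poly_Mapping.lookup X p) (word p) \<nu>) else 0)"
    using alg_cut[of v X \<nu>] assms(2,3) by (simp add: X(1) mult.assoc)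
  have *: "word p = []" "target p = source p" if "p \<in> Poly_Mapping.keys X" for p
    using X(2) that by (auto simp: plen_def target_def)
  have "\<exists>c. x = scl c v * scl 1 v"
    unfolding x
  proof (rule sum_scl_mult)
    fix p assume p: "p \<in> Poly_Mapping.keys X"
    show "\<exists>c. (if target p = v \<and> source p = \<nu>
       then to_alg (mon (Poly_Mapping.lookup X p) (word p) \<nu>) else 0) = scl c v * scl 1 v"
      using *[OF p] by (auto simp: scl_mult simp flip: scl_def intro: exI[of _ 0])
  qed
  then show "\<exists>c. x = scl c v" by (auto simp: scl_mult)
  show "x = 0" if "v \<noteq> \<nu>"
    using that * by (subst x, intro sum.neutral) auto
qed

text \<open>At most one arrow joins two given vertices, and its scalar \<open>scal\<close> is
  invertible, so \<open>arr\<close> spans this piece.\<close>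

lemma alg_degree_1:
  assumes "x \<in> alg_degree 1" "scl 1 v * x = x" "x * scl 1 \<nu> = x"
  shows "\<exists>c. x = scl c v * arr \<nu> v"
proof -
  obtain X where X: "x = to_alg X" "\<forall>p\<in>Poly_Mapping.keys X. plen p = 1"
    using assms(1) by (auto simp: alg_degree_def)
  have x: "x = (\<Sum>p\<in>Poly_Mapping.keys X. if target p = v \<and> source p = \<nu>
       then to_alg (mon (Poly_Mapping.lookup X p) (word p) \<nu>) else 0)"
    using alg_cut[of v X \<nu>] assms(2,3) by (simp add: X(1) mult.assoc)
  show ?thesis
    unfolding x
  proof (rule sum_scl_mult)
    fix p assume p: "p \<in> Poly_Mapping.keys X"
    show "\<exists>c. (if target p = v \<and> source p = \<nu>
       then to_alg (mon (Poly_Mapping.lookup X p) (word p) \<nu>) else 0) = scl c v * arr \<nu> v"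
    proof (cases "target p = v \<and> source p = \<nu>")
      case True
      obtain z where z: "word p = [z]"
        using X(2) p by (auto simp: plen_def length_Suc_conv)
      have h: "has_arrow z \<nu>" "arrow_target z \<nu> = v"
        using is_path_rep[of p] True by (auto simp: z target_def)
      then have "arr \<nu> v = to_alg (mon (scal z \<nu>) [z] \<nu>)" using arr_arrow by blast
      then show ?thesis
        using True h scal_nonzero[OF h(1)]
        by (intro exI[of _ "Poly_Mapping.lookup X p / scal z \<nu>"]) (simp add: z scl_mult_mon)
    qed (auto intro: exI[of _ 0])
  qed
qed

lemma alg_degree_neg: "x \<in> alg_degree i \<Longrightarrow> i < 0 \<Longrightarrow> x = 0"
proof -
  assume "x \<in> alg_degree i" "i < 0"
  then obtain X where X: "x = to_alg X" "Poly_Mapping.keys X = {}"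
    by (fastforce simp: alg_degree_def)
  then show "x = 0" by simp
qed

lemma scl_arr_alg_degree: "scl c v * arr \<nu> v \<in> alg_degree 1"
proof (cases "edge \<nu> v")
  case True
  then have "scl c v * arr \<nu> v = to_alg (mon (c * scal (link \<nu> v) \<nu>) [link \<nu> v] \<nu>)"
    by (simp add: arr_def scl_mult_mon edge_def)
  then show ?thesis by (auto simp: alg_degree_def intro!: imageI dest: keys_mon)
next
  case False
  then show ?thesis by (auto simp: arr_eq_0 alg_degree_def intro!: image_eqI[of _ _ 0])
qed

lemma zero_alg_degree: "0 \<in> alg_degree i"
  by (auto simp: alg_degree_def intro!: image_eqI[of _ _ 0])

section \<open>Submodules and homogeneous components in coordinates\<close>

lemma lookup_act: "Poly_Mapping.lookup (act r x) j = r * Poly_Mapping.lookup x j"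
  by (auto simp: act_def Poly_Mapping.map.rep_eq when_def)

lemma act_act: "act r (act s x) = act (r * s) x"
  by (intro poly_mapping_eqI) (simp add: lookup_act mult.assoc)

lemma generated_base: "x \<in> S \<Longrightarrow> x \<in> generated S"
  by (auto simp: generated_def)

lemma generated_0: "0 \<in> generated S"
  by (auto simp: generated_def)

lemma generated_diff: "x \<in> generated S \<Longrightarrow> y \<in> generated S \<Longrightarrow> x - y \<in> generated S"
  by (auto simp: generated_def)

lemma generated_act: "x \<in> generated S \<Longrightarrow> act r x \<in> generated S"
  by (auto simp: generated_def)

lemma generated_uminus: "x \<in> generated S \<Longrightarrow> - x \<in> generated S"
  using generated_diff[OF generated_0] by fastforce

lemma generated_add: "x \<in> generated S \<Longrightarrow> y \<in> generated S \<Longrightarrow> x + y \<in> generated S"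
  using generated_diff[OF _ generated_uminus] by fastforce

lemma generated_sum: "(\<And>s. s \<in> A \<Longrightarrow> f s \<in> generated S) \<Longrightarrow> sum f A \<in> generated S"
  by (induction A rule: infinite_finite_induct) (auto intro: generated_0 generated_add)

lemma generated_least:
  assumes "S \<subseteq> N" "0 \<in> N" "\<And>x y. x \<in> N \<Longrightarrow> y \<in> N \<Longrightarrow> x - y \<in> N" "\<And>r x. x \<in> N \<Longrightarrow> act r x \<in> N"
  shows "generated S \<subseteq> N"
  using assms by (auto simp: generated_def)

lemma generated_subset: "S \<subseteq> generated T \<Longrightarrow> generated S \<subseteq> generated T"
  by (rule generated_least) (auto intro: generated_0 generated_diff generated_act)

lemma componentD:
  assumes "x \<in> component F v i"
  shows "scl 1 v * Poly_Mapping.lookup x j = Poly_Mapping.lookup x j"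
    "act (scl 1 v) x = x"
    "j \<in> idx F \<Longrightarrow> Poly_Mapping.lookup x j * scl 1 (wt F j) = Poly_Mapping.lookup x j"
    "j \<notin> idx F \<Longrightarrow> Poly_Mapping.lookup x j = 0"
    "j \<in> idx F \<Longrightarrow> Poly_Mapping.lookup x j \<in> alg_degree (i - dg F j)"
proof -
  obtain y where y: "x = act (scl 1 v) y"
    using assms by (auto simp: component_def idem_eq_scl)
  show 1: "act (scl 1 v) x = x" by (simp add: y act_act scl_mult)
  then show "scl 1 v * Poly_Mapping.lookup x j = Poly_Mapping.lookup x j" by (metis lookup_act)
  show "j \<notin> idx F \<Longrightarrow> Poly_Mapping.lookup x j = 0"
    "j \<in> idx F \<Longrightarrow> Poly_Mapping.lookup x j \<in> alg_degree (i - dg F j)"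
    using assms by (auto simp: component_def elements_def in_keys_iff)
  show "Poly_Mapping.lookup x j * scl 1 (wt F j) = Poly_Mapping.lookup x j" if "j \<in> idx F"
  proof -
    have "Poly_Mapping.lookup x j \<in> proj (wt F j)"
      using assms that by (auto simp: component_def elements_def)
    then show ?thesis by (auto simp: proj_def idem_eq_scl mult.assoc scl_mult)
  qed
qed

lemma componentI:
  assumes "\<And>j. scl 1 v * Poly_Mapping.lookup x j = Poly_Mapping.lookup x j"
    "\<And>j. j \<in> idx F \<Longrightarrow> Poly_Mapping.lookup x j * scl 1 (wt F j) = Poly_Mapping.lookup x j"
    "\<And>j. j \<notin> idx F \<Longrightarrow> Poly_Mapping.lookup x j = 0"
    "\<And>j. j \<in> idx F \<Longrightarrow> Poly_Mapping.lookup x j \<in> alg_degree (i - dg F j)"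
  shows "x \<in> component F v i"
proof -
  have "Poly_Mapping.lookup x j \<in> proj (wt F j)" if "j \<in> idx F" for j
    using assms(2)[OF that] by (auto simp: proj_def idem_eq_scl intro: sym)
  then have "x \<in> elements F" using assms(3) by (auto simp: elements_def in_keys_iff)
  moreover have "x = act (idem v) x"
    by (intro poly_mapping_eqI) (simp add: lookup_act idem_eq_scl assms(1))
  ultimately show ?thesis using assms(4) by (auto simp: component_def)
qed

lemma lookup_diff_map:
  assumes "finite K" "Poly_Mapping.keys x \<subseteq> K"
  shows "Poly_Mapping.lookup (diff_map h x) k =
    (\<Sum>j\<in>K. Poly_Mapping.lookup x j * Poly_Mapping.lookup (h j) k)"
proof -
  have "Poly_Mapping.lookup (diff_map h x) k =
      (\<Sum>j\<in>Poly_Mapping.keys x. Poly_Mapping.lookup x j * Poly_Mapping.lookup (h j) k)"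
    by (simp add: diff_map_def lookup_sum lookup_act)
  also have "\<dots> = (\<Sum>j\<in>K. Poly_Mapping.lookup x j * Poly_Mapping.lookup (h j) k)"
    using assms by (intro sum.mono_neutral_left) (auto simp: in_keys_iff)
  finally show ?thesis .
qed

section \<open>The diagonal of the resolution\<close>

text \<open>This isolates the combinatorics that determines the diagonal: \<open>level_mids\<close>
  makes the family of equal scalars a solution, \<open>level_connected\<close> forces every solution
  to be of this kind, and \<open>level_obstructed\<close> forces it to vanish when v is outside the
  next level. Level 1 is separate because the kernel of the augmentation imposes no equation in
  degree one.\<close>

locale levels =
  fixes \<mu> :: weight and L :: "nat \<Rightarrow> weight set"
  assumes \<mu>: "\<mu> \<in> Lambda_odd"
    and level_0: "L 0 = {\<mu>}"
    and level_1: "v \<in> L 1 \<longleftrightarrow> edge \<mu> v"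
    and level_pred: "v \<in> L (Suc n) \<Longrightarrow> \<exists>\<nu>\<in>L n. edge \<nu> v"
    and level_mids: "\<lbrakk>v \<in> L (Suc (Suc n)); \<rho> \<in> L n; \<nu> \<in> L (Suc n); edge \<rho> \<nu>; edge \<nu> v\<rbrakk> \<Longrightarrow>
      \<not> free_pair \<rho> v \<and> mids \<rho> v \<subseteq> L (Suc n)"
    and level_connected: "\<lbrakk>v \<in> L (Suc (Suc n)); \<nu> \<in> L (Suc n); \<nu>' \<in> L (Suc n);
      edge \<nu> v; edge \<nu>' v; \<nu> \<noteq> \<nu>'\<rbrakk> \<Longrightarrow> \<exists>\<rho>\<in>L n. edge \<rho> \<nu> \<and> edge \<rho> \<nu>'"
    and level_obstructed: "\<lbrakk>v \<notin> L (Suc (Suc n)); \<nu> \<in> L (Suc n); edge \<nu> v\<rbrakk> \<Longrightarrow>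
      \<exists>\<rho>\<in>L n. edge \<rho> \<nu> \<and> (free_pair \<rho> v \<or> \<not> mids \<rho> v \<subseteq> L (Suc n))"
begin

lemma level_Lambda_odd: "v \<in> L n \<Longrightarrow> v \<in> Lambda_odd"
proof (induction n arbitrary: v)
  case 0
  then show ?case using \<mu> level_0 by simp
next
  case (Suc n)
  then show ?case using level_pred edge_Lambda_odd by blast
qed

lemma finite_level: "finite (L n)"
proof (induction n)
  case 0
  then show ?case by (simp add: level_0)
next
  case (Suc n)
  have "finite {v. edge \<nu> v}" for \<nu>
  proof -
    obtain a b where "\<nu> = (a, b)" by fastforce
    then have "{v. edge \<nu> v} \<subseteq> {(a + 2, b + 1), (- a - 2, b), (a - 2, b + 1)}"
      by (auto simp: edge_iff)
    then show ?thesis by (rule finite_subset) simp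
  qed
  then have "finite (\<Union>\<nu>\<in>L n. {v. edge \<nu> v})" using Suc by blast
  moreover have "L (Suc n) \<subseteq> (\<Union>\<nu>\<in>L n. {v. edge \<nu> v})" using level_pred by blast
  ultimately show ?case by (rule finite_subset[rotated])
qed

lemma level_equations_imp_constant:
  assumes v: "v \<in> Lambda_odd"
    and eq: "\<And>\<rho>. \<rho> \<in> L n \<Longrightarrow> (\<Sum>\<nu>\<in>L (Suc n). scl (w \<nu>) v * (arr \<nu> v * arr \<rho> \<nu>)) = 0"
  shows "\<exists>c. (v \<notin> L (Suc (Suc n)) \<longrightarrow> c = 0) \<and> (\<forall>\<nu>\<in>L (Suc n). edge \<nu> v \<longrightarrow> w \<nu> = c)"
proof (cases "v \<in> L (Suc (Suc n))")
  case True
  then obtain \<nu>0 where \<nu>0: "\<nu>0 \<in> L (Suc n)" "edge \<nu>0 v" using level_pred by blast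
  have "w \<nu> = w \<nu>0" if \<nu>: "\<nu> \<in> L (Suc n)" "edge \<nu> v" for \<nu>
  proof (cases "\<nu> = \<nu>0")
    case False
    then obtain \<rho> where \<rho>: "\<rho> \<in> L n" "edge \<rho> \<nu>" "edge \<rho> \<nu>0"
      using level_connected[OF True \<nu>(1) \<nu>0(1)] \<nu> \<nu>0 by blast
    have "\<nu> \<in> mids \<rho> v" "\<nu>0 \<in> mids \<rho> v" using \<rho> \<nu> \<nu>0 by (simp_all add: mids_def)
    with two_step_sum_eq_0(2)[OF level_Lambda_odd[OF \<rho>(1)] finite_level eq[OF \<rho>(1)]] \<nu>(1) \<nu>0(1)
    show ?thesis by blast
  qed simp
  with True show ?thesis by blast
next
  case False
  have "w \<nu> = 0" if \<nu>: "\<nu> \<in> L (Suc n)" "edge \<nu> v" for \<nu>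
  proof -
    obtain \<rho> where \<rho>: "\<rho> \<in> L n" "edge \<rho> \<nu>" "free_pair \<rho> v \<or> \<not> mids \<rho> v \<subseteq> L (Suc n)"
      using level_obstructed[OF False \<nu>] by blast
    have "\<nu> \<in> mids \<rho> v" using \<rho> \<nu> by (simp add: mids_def)
    from two_step_sum_eq_0(1)[OF level_Lambda_odd[OF \<rho>(1)] finite_level eq[OF \<rho>(1)] \<nu>(1) this \<rho>(3)]
    show ?thesis .
  qed
  then show ?thesis by blast
qed

text \<open>For each \<rho> the level contains either none of the middle vertices or all of them,
  and in the second case the sum is zero by the relations of the algebra.\<close>

lemma level_equations_hold:
  assumes "v \<in> L (Suc (Suc n))" "\<rho> \<in> L n"
  shows "(\<Sum>\<nu>\<in>L (Suc n). arr \<nu> v * arr \<rho> \<nu>) = 0"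
proof (cases "L (Suc n) \<inter> mids \<rho> v = {}")
  case True
  show ?thesis
  proof (intro sum.neutral ballI)
    fix \<nu> assume "\<nu> \<in> L (Suc n)"
    with True have "\<not> (edge \<rho> \<nu> \<and> edge \<nu> v)" by (auto simp: mids_def)
    then show "arr \<nu> v * arr \<rho> \<nu> = 0" by (auto simp: arr_eq_0)
  qed
next
  case False
  then have "\<not> free_pair \<rho> v" "mids \<rho> v \<subseteq> L (Suc n)"
    using level_mids[OF assms] by (auto simp: mids_def)
  moreover have "(\<Sum>\<nu>\<in>L (Suc n). arr \<nu> v * arr \<rho> \<nu>) = (\<Sum>\<nu>\<in>mids \<rho> v. arr \<nu> v * arr \<rho> \<nu>)"
  proof (intro sum.mono_neutral_right finite_level calculation(2) ballI)
    fix \<nu> assume "\<nu> \<in> L (Suc n) - mids \<rho> v"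
    then have "\<not> (edge \<rho> \<nu> \<and> edge \<nu> v)" by (simp add: mids_def)
    then show "arr \<nu> v * arr \<rho> \<nu> = 0" by (auto simp: arr_eq_0)
  qed
  ultimately show ?thesis using sum_mids_eq_0 level_Lambda_odd assms(2) by simp
qed

end

section \<open>Comparison of an arbitrary minimal resolution with the levels\<close>

locale level_resolution = levels +
  fixes R :: "nat \<Rightarrow> 'i graded_proj" and gen :: "nat \<Rightarrow> 'i \<Rightarrow> ('i \<Rightarrow>\<^sub>0 alg)"
  assumes resolution: "minimal_resolution \<mu> R gen"
begin

definition diag :: "nat \<Rightarrow> 'i set" where
  "diag n = {j \<in> idx (R n). dg (R n) j = int n}"

lemma idx_0: obtains j where "idx (R 0) = {j}" "wt (R 0) j = \<mu>" "dg (R 0) j = 0"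
  using resolution by (auto simp: minimal_resolution_def)

lemma inj_gen: "inj_on (gen (Suc n)) (idx (R (Suc n)))"
  using resolution by (auto simp: minimal_resolution_def)

lemma generated_gen: "generated (gen (Suc n) ` idx (R (Suc n))) = ker_phi \<mu> R gen n"
  using resolution by (auto simp: minimal_resolution_def minimal_hom_generating_set_def)

lemma gen_component:
  assumes "j \<in> idx (R (Suc n))"
  shows "gen (Suc n) j \<in> component (R n) (wt (R (Suc n)) j) (dg (R (Suc n)) j)"
    "wt (R (Suc n)) j \<in> Lambda_odd"
  using resolution assms by (auto simp: minimal_resolution_def)

lemma gen_ker: "j \<in> idx (R (Suc n)) \<Longrightarrow> gen (Suc n) j \<in> ker_phi \<mu> R gen n"
  using generated_gen[of n] generated_base by blast

text \<open>Minimality speaks of proper subsets of the generating set; injectivity of the labelling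
  turns removal of a label into removal of an element.\<close>

lemma gen_not_redundant:
  assumes "j \<in> idx (R (Suc n))"
  shows "gen (Suc n) j \<notin> generated (gen (Suc n) ` (idx (R (Suc n)) - {j}))"
proof
  let ?G = "gen (Suc n) ` idx (R (Suc n))" and ?H = "gen (Suc n) ` (idx (R (Suc n)) - {j})"
  assume h: "gen (Suc n) j \<in> generated ?H"
  have "?G \<subseteq> generated ?H"
  proof
    fix x assume "x \<in> ?G"
    then show "x \<in> generated ?H" using h by (cases "x = gen (Suc n) j") (auto intro!: generated_base)
  qed
  then have "generated ?G \<subseteq> generated ?H" by (rule generated_subset)
  moreover have "generated ?H \<subseteq> generated ?G"
    by (rule generated_subset) (auto intro: generated_base)
  ultimately have "generated ?H = ker_phi \<mu> R gen n" using generated_gen by blast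
  moreover have "?H \<subset> ?G"
  proof -
    have "gen (Suc n) j \<notin> ?H" using inj_onD[OF inj_gen] assms by blast
    then show ?thesis using assms by blast
  qed
  ultimately show False
    using resolution by (auto simp: minimal_resolution_def minimal_hom_generating_set_def)
qed

lemma gen_nonzero: "j \<in> idx (R (Suc n)) \<Longrightarrow> gen (Suc n) j \<noteq> 0"
  using gen_not_redundant generated_0 by metis

text \<open>This is the containment of the kernel in the radical. A nonzero multiple of an
  idempotent at \<open>j\<close> can be inverted, and \<open>diff_map (gen n) x = 0\<close> would
  then express generator \<open>j\<close> through the others; for n = 0 the augmentation would not
  vanish.\<close>

lemma ker_lookup_scl:
  assumes x: "x \<in> ker_phi \<mu> R gen n" "x \<in> component (R n) v i"
    and j: "j \<in> idx (R n)" "Poly_Mapping.lookup x j = scl c v" "wt (R n) j = v" and v: "v \<in> Lambda_odd"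
  shows "c = 0"
proof (cases n)
  case 0
  obtain j0 where j0: "idx (R 0) = {j0}" "wt (R 0) j0 = \<mu>" by (rule idx_0)
  then have e: "j = j0" "v = \<mu>" using j 0 by auto
  have "Poly_Mapping.lookup x k = 0" if "k \<noteq> j" for k
    using componentD(4)[OF x(2)] j0 0 e that by auto
  then have "x = Poly_Mapping.single j (scl c v)"
    by (intro poly_mapping_eqI) (auto simp: lookup_single j(2) when_def)
  moreover have "aug \<mu> x = 0" using x(1) 0 by simp
  ultimately have "scl c v = 0 \<or> top_coeff \<mu> (scl c v) = 0"
    by (auto simp: aug_def split: if_splits)
  then show ?thesis
  proof
    assume "top_coeff \<mu> (scl c v) = 0"
    then show ?thesis using v by (simp add: e scl_def top_coeff.abs_eq mon_def)
  qed (use v scl_eq_0 in simp)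
next
  case (Suc m)
  let ?G = "generated (gen n ` (idx (R n) - {j}))"
  show ?thesis
  proof (rule ccontr)
    assume c: "c \<noteq> 0"
    then have k: "j \<in> Poly_Mapping.keys x" using j v by (simp add: in_keys_iff scl_eq_0)
    have "diff_map (gen n) x = 0" using x(1) Suc by simp
    then have "0 = act (scl c v) (gen n j) +
        (\<Sum>k\<in>Poly_Mapping.keys x - {j}. act (Poly_Mapping.lookup x k) (gen n k))"
      unfolding diff_map_def using sum.remove[OF finite_keys k] j(2) by metis
    then have "act (scl c v) (gen n j) =
        - (\<Sum>k\<in>Poly_Mapping.keys x - {j}. act (Poly_Mapping.lookup x k) (gen n k))"
      by (metis eq_neg_iff_add_eq_0)
    moreover have "gen n k \<in> ?G" if "k \<in> Poly_Mapping.keys x - {j}" for k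
      using that componentD(4)[OF x(2), of k] by (intro generated_base) (auto simp: in_keys_iff)
    ultimately have "act (scl c v) (gen n j) \<in> ?G"
      by (auto intro!: generated_uminus generated_sum generated_act)
    then have "act (scl (1 / c) v) (act (scl c v) (gen n j)) \<in> ?G" by (rule generated_act)
    moreover have "act (scl (1 / c) v) (act (scl c v) (gen n j)) = gen n j"
      using c componentD(2)[OF gen_component(1), of j m] j Suc by (simp add: act_act scl_mult)
    ultimately show False using gen_not_redundant[of j m] j(1) Suc by simp
  qed
qed

text \<open>The invariant of the induction. The matrix of the linear differential consists of all
  the rescaled arrows between consecutive levels, up to row factors \<open>t\<close> and column
  factors \<open>u\<close>; the inductive step takes \<open>u\<close> to be 1 / t of the level
  before. Of the generators off the diagonal only a lower bound for the degree is kept.\<close>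

definition level_basis :: "nat \<Rightarrow> ('i \<Rightarrow> complex) \<Rightarrow> ('i \<Rightarrow> complex) \<Rightarrow> bool" where
  "level_basis n t u \<longleftrightarrow>
    (\<forall>j\<in>idx (R n). int n \<le> dg (R n) j) \<and> bij_betw (wt (R n)) (diag n) (L n) \<and>
    (\<forall>j\<in>diag n. t j \<noteq> 0) \<and>
    (\<forall>m. n = Suc m \<longrightarrow> bij_betw (wt (R m)) (diag m) (L m) \<and> (\<forall>j\<in>diag m. u j \<noteq> 0) \<and>
      (\<forall>j\<in>diag n. \<forall>k. Poly_Mapping.lookup (gen n j) k =
        (if k \<in> diag m then scl (t j * u k) (wt (R n) j) * arr (wt (R m) k) (wt (R n) j) else 0)))"

text \<open>All entries of x have degree at most 0; negative degrees are empty and degree 0 is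
  excluded by \<open>ker_lookup_scl\<close>. Hence the next generators start in degree n +
  1.\<close>

lemma ker_low_degree:
  assumes B: "level_basis n t u" and v: "v \<in> Lambda_odd"
    and x: "x \<in> ker_phi \<mu> R gen n" "x \<in> component (R n) v i" and i: "i \<le> int n"
  shows "x = 0"
proof (rule poly_mapping_eqI)
  fix j
  show "Poly_Mapping.lookup x j = Poly_Mapping.lookup 0 j"
  proof (cases "j \<in> idx (R n)")
    case True
    note c = componentD(1,3,5)[OF x(2), of j]
    have "int n \<le> dg (R n) j" using B True by (auto simp: level_basis_def)
    then consider "i < dg (R n) j" | "i = dg (R n) j" using i by linarith
    then show ?thesis
    proof cases
      case 1
      then show ?thesis using alg_degree_neg[OF c(3)[OF True]] by simp
    next
      case 2
      then have h: "Poly_Mapping.lookup x j \<in> alg_degree 0" using c(3)[OF True] by simp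
      obtain d where d: "Poly_Mapping.lookup x j = scl d v"
        using alg_degree_0(1)[OF h c(1) c(2)[OF True]] by blast
      show ?thesis
      proof (cases "v = wt (R n) j")
        case True
        then have "d = 0" using ker_lookup_scl[OF x \<open>j \<in> idx (R n)\<close> d] v by simp
        then show ?thesis by (simp add: d)
      next
        case False
        then show ?thesis using alg_degree_0(2)[OF h c(1) c(2)[OF True]] by simp
      qed
    qed
  next
    case False
    then show ?thesis using componentD(4)[OF x(2)] by simp
  qed
qed

lemma ker_diag_lookup:
  assumes B: "level_basis n t u" and v: "v \<in> Lambda_odd"
    and x: "x \<in> ker_phi \<mu> R gen n" "x \<in> component (R n) v (int (Suc n))"
  shows "\<exists>y. \<forall>j. Poly_Mapping.lookup x j = (if j \<in> diag n then scl (y j) v * arr (wt (R n) j) v else 0)"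
proof -
  have "\<exists>c. Poly_Mapping.lookup x j = (if j \<in> diag n then scl c v * arr (wt (R n) j) v else 0)" for j
  proof (cases "j \<in> idx (R n)")
    case True
    note c = componentD(1,3,5)[OF x(2), of j]
    have "int n \<le> dg (R n) j" using B True by (auto simp: level_basis_def)
    then consider "int (Suc n) < dg (R n) j" | "int (Suc n) = dg (R n) j" | "int n = dg (R n) j" by linarith
    then show ?thesis
    proof cases
      case 1
      then show ?thesis using alg_degree_neg[OF c(3)[OF True]] by (simp add: diag_def)
    next
      case 2
      \<comment> \<open>A generator of degree n + 1 lies off the diagonal of \<open>R n\<close>; the
        entry there has degree 0 and vanishes by minimality.\<close>
      then have h: "Poly_Mapping.lookup x j \<in> alg_degree 0" using c(3)[OF True] by simp
      obtain d where d: "Poly_Mapping.lookup x j = scl d v"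
        using alg_degree_0(1)[OF h c(1) c(2)[OF True]] by blast
      have "Poly_Mapping.lookup x j = 0"
      proof (cases "v = wt (R n) j")
        case True
        then have "d = 0" using ker_lookup_scl[OF x \<open>j \<in> idx (R n)\<close> d] v by simp
        then show ?thesis by (simp add: d)
      next
        case False
        then show ?thesis using alg_degree_0(2)[OF h c(1) c(2)[OF True]] by simp
      qed
      then show ?thesis using 2 by (simp add: diag_def)
    next
      case 3
      then have "Poly_Mapping.lookup x j \<in> alg_degree 1" using c(3)[OF True] by simp
      from alg_degree_1[OF this c(1) c(2)[OF True]] show ?thesis using 3 True by (simp add: diag_def)
    qed
  next
    case False
    then show ?thesis using componentD(4)[OF x(2)] by (simp add: diag_def)
  qed
  then show ?thesis by metis
qed

lemma finite_diag: "level_basis n t u \<Longrightarrow> finite (diag n)"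
  using finite_level by (auto simp: level_basis_def bij_betw_finite)

text \<open>In the coordinates \<open>y j * t j\<close> the differential no longer depends on the choice of the
  generators.\<close>

lemma lookup_diff_map_diag:
  assumes B: "level_basis (Suc m) t u"
    and x: "\<And>j. Poly_Mapping.lookup x j = (if j \<in> diag (Suc m) then scl (y j) v * arr (wt (R (Suc m)) j) v else 0)"
    and w: "\<And>j. j \<in> diag (Suc m) \<Longrightarrow> w (wt (R (Suc m)) j) = y j * t j"
  shows "Poly_Mapping.lookup (diff_map (gen (Suc m)) x) k =
    (if k \<in> diag m then scl (u k) v *
      (\<Sum>\<nu>\<in>L (Suc m). scl (w \<nu>) v * (arr \<nu> v * arr (wt (R m) k) \<nu>)) else 0)"
proof -
  let ?wt = "wt (R (Suc m))"
  have g: "Poly_Mapping.lookup (gen (Suc m) j) k =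
      (if k \<in> diag m then scl (t j * u k) (?wt j) * arr (wt (R m) k) (?wt j) else 0)"
    if "j \<in> diag (Suc m)" for j k
    using B that by (auto simp: level_basis_def)
  have "Poly_Mapping.keys x \<subseteq> diag (Suc m)"
    using x by (auto simp: in_keys_iff split: if_splits)
  from lookup_diff_map[OF finite_diag[OF B] this]
  have 1: "Poly_Mapping.lookup (diff_map (gen (Suc m)) x) k =
    (\<Sum>j\<in>diag (Suc m). scl (y j) v * arr (?wt j) v * Poly_Mapping.lookup (gen (Suc m) j) k)"
    by (simp add: x)
  show ?thesis
  proof (cases "k \<in> diag m")
    case True
    have "scl (y j) v * arr (?wt j) v * Poly_Mapping.lookup (gen (Suc m) j) k =
      scl (u k) v * (scl (w (?wt j)) v * (arr (?wt j) v * arr (wt (R m) k) (?wt j)))"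
      if j: "j \<in> diag (Suc m)" for j
    proof -
      have "scl (y j) v * arr (?wt j) v * Poly_Mapping.lookup (gen (Suc m) j) k =
        scl (y j) v * (arr (?wt j) v * scl (t j * u k) (?wt j)) * arr (wt (R m) k) (?wt j)"
        by (simp add: g[OF j] True mult.assoc)
      also have "\<dots> = scl (y j) v * scl (t j * u k) v * (arr (?wt j) v * arr (wt (R m) k) (?wt j))"
        by (simp add: arr_scl mult.assoc)
      also have "scl (y j) v * scl (t j * u k) v = scl (u k) v * scl (w (?wt j)) v"
        by (simp add: scl_mult w[OF j] mult_ac)
      finally show ?thesis by (simp add: mult.assoc)
    qed
    then have "Poly_Mapping.lookup (diff_map (gen (Suc m)) x) k = scl (u k) v *
      (\<Sum>j\<in>diag (Suc m). scl (w (?wt j)) v * (arr (?wt j) v * arr (wt (R m) k) (?wt j)))"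
      unfolding 1 sum_distrib_left by (intro sum.cong) auto
    also have "(\<Sum>j\<in>diag (Suc m). scl (w (?wt j)) v * (arr (?wt j) v * arr (wt (R m) k) (?wt j))) =
      (\<Sum>\<nu>\<in>L (Suc m). scl (w \<nu>) v * (arr \<nu> v * arr (wt (R m) k) \<nu>))"
      using B by (intro sum.reindex_bij_betw) (simp add: level_basis_def)
    finally show ?thesis using True by simp
  next
    case False
    then show ?thesis unfolding 1 by (simp add: g)
  qed
qed

text \<open>In the coordinates \<open>w\<close> the kernel condition is the system of level
  equations, the same for every choice of generators, and its solutions are constant along the edges
  into v. Dividing by \<open>t\<close> returns to the entries of x.\<close>

lemma ker_diag:
  assumes B: "level_basis n t u" and v: "v \<in> Lambda_odd"
    and x: "x \<in> ker_phi \<mu> R gen n" "x \<in> component (R n) v (int (Suc n))"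
  shows "\<exists>c. (v \<notin> L (Suc n) \<longrightarrow> c = 0) \<and> (\<forall>j. Poly_Mapping.lookup x j =
    (if j \<in> diag n then scl (c / t j) v * arr (wt (R n) j) v else 0))"
proof -
  obtain y where y: "\<And>j. Poly_Mapping.lookup x j =
      (if j \<in> diag n then scl (y j) v * arr (wt (R n) j) v else 0)"
    using ker_diag_lookup[OF assms] by blast
  have t: "t j \<noteq> 0" if "j \<in> diag n" for j using B that by (auto simp: level_basis_def)
  have bij: "bij_betw (wt (R n)) (diag n) (L n)" using B by (auto simp: level_basis_def)
  define w where "w \<nu> = (let j = the_inv_into (diag n) (wt (R n)) \<nu> in y j * t j)" for \<nu>
  have w: "w (wt (R n) j) = y j * t j" if "j \<in> diag n" for j
    using that bij by (simp add: w_def the_inv_into_f_f bij_betw_def)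
  have "\<exists>c. (v \<notin> L (Suc n) \<longrightarrow> c = 0) \<and> (\<forall>\<nu>\<in>L n. edge \<nu> v \<longrightarrow> w \<nu> = c)"
  proof (cases n)
    case 0
    \<comment> \<open>There is no equation here: the only possible edge runs from \<mu> to v, and it
      exists exactly when v is in level 1.\<close>
    show ?thesis
      using level_1[of v] by (intro exI[of _ "if v \<in> L 1 then w \<mu> else 0"]) (auto simp: 0 level_0)
  next
    case (Suc m)
    note B' = B[unfolded Suc] 
    have bm: "bij_betw (wt (R m)) (diag m) (L m)" and u: "\<And>j. j \<in> diag m \<Longrightarrow> u j \<noteq> 0"
      using B' by (auto simp: level_basis_def)
    have "(\<Sum>\<nu>\<in>L (Suc m). scl (w \<nu>) v * (arr \<nu> v * arr \<rho> \<nu>)) = 0" (is "?S = 0") if \<rho>: "\<rho> \<in> L m" for \<rho>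
    proof -
      obtain k where k: "k \<in> diag m" "wt (R m) k = \<rho>"
        using bij_betw_imp_surj_on[OF bm] \<rho> by (metis imageE)
      have "diff_map (gen (Suc m)) x = 0" using x(1) Suc by simp
      then have "scl (u k) v * ?S = 0"
        using lookup_diff_map_diag[OF B' y[unfolded Suc] w[unfolded Suc], of k] k by simp
      then have "scl (1 / u k) v * (scl (u k) v * ?S) = 0" by simp
      then have "scl 1 v * ?S = 0" using u[OF k(1)] by (simp add: scl_mult flip: mult.assoc)
      then show ?thesis by (simp add: sum_distrib_left scl_mult flip: mult.assoc)
    qed
    from level_equations_imp_constant[OF v this] show ?thesis by (simp add: Suc)
  qed
  then obtain c where c: "v \<notin> L (Suc n) \<longrightarrow> c = 0" "\<And>\<nu>. \<nu> \<in> L n \<Longrightarrow> edge \<nu> v \<Longrightarrow> w \<nu> = c" by blast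
  have "scl (y j) v * arr (wt (R n) j) v = scl (c / t j) v * arr (wt (R n) j) v" if j: "j \<in> diag n" for j
  proof (cases "edge (wt (R n) j) v")
    case True
    then have "y j * t j = c" using c(2)[OF _ True] w[OF j] bij_betwE[OF bij] j by simp
    then show ?thesis using t[OF j] by auto
  qed (simp add: arr_eq_0)
  with c(1) y show ?thesis by auto
qed

lemma ker_diag_exists:
  assumes B: "level_basis n t u" and v: "v \<in> L (Suc n)"
  shows "\<exists>x\<in>ker_phi \<mu> R gen n. \<forall>j. Poly_Mapping.lookup x j =
    (if j \<in> diag n then scl (1 / t j) v * arr (wt (R n) j) v else 0)"
proof -
  have t: "t j \<noteq> 0" if "j \<in> diag n" for j using B that by (auto simp: level_basis_def)
  define x where "x = (\<Sum>j\<in>diag n. Poly_Mapping.single j (scl (1 / t j) v * arr (wt (R n) j) v))"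
  have x: "Poly_Mapping.lookup x j = (if j \<in> diag n then scl (1 / t j) v * arr (wt (R n) j) v else 0)" for j
    using finite_diag[OF B] by (simp add: x_def lookup_sum lookup_single when_def sum.delta)
  have "x \<in> component (R n) v (int (Suc n))"
    by (rule componentI)
       (simp_all add: x diag_def zero_alg_degree scl_arr_alg_degree scl_mult_left mult.assoc arr_scl scl_arr)
  then have xe: "x \<in> elements (R n)" by (simp add: component_def)
  have "x \<in> ker_phi \<mu> R gen n"
  proof (cases n)
    case 0
    have "top_coeff \<mu> (Poly_Mapping.lookup x j) = 0" for j
    proof -
      have "top_coeff \<mu> y = 0" if y: "y \<in> alg_degree 1" for y
      proof (cases "\<mu> \<in> Lambda_odd")
        case True
        then have "top_coeff \<mu> y = coeff (Abs_path ([], \<mu>)) y"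
          by transfer (simp add: plen_def word_Abs)
        then show ?thesis using coeff_alg_degree[OF y] True by (simp add: plen_def word_Abs)
      qed (use \<mu> in simp)
      then show ?thesis by (auto simp: x scl_arr_alg_degree zero_alg_degree)
    qed
    then show ?thesis using xe 0 by (simp add: aug_def)
  next
    case (Suc m)
    note B' = B[unfolded Suc] 
    have bm: "bij_betw (wt (R m)) (diag m) (L m)" using B' by (auto simp: level_basis_def)
    \<comment> \<open>With y = 1 / t every coordinate w is 1, the constant solution.\<close>
    have "Poly_Mapping.lookup (diff_map (gen (Suc m)) x) k = 0" for k
      using lookup_diff_map_diag[OF B' x[unfolded Suc], of "\<lambda>_. 1" k] t level_equations_hold[of v m "wt (R m) k"] v bij_betwE[OF bm]
      by (auto simp: Suc scl_arr simp flip: mult.assoc)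
    then have "diff_map (gen (Suc m)) x = 0" by (intro poly_mapping_eqI) simp
    then show ?thesis using xe Suc by simp
  qed
  with x show ?thesis by blast
qed

lemma scl_div_arr_eq_0:
  assumes "\<And>j. Poly_Mapping.lookup x j = (if j \<in> D then scl (c / t j) v * arr (\<nu> j) v else 0)" "x \<noteq> 0"
  shows "c \<noteq> 0"
  using assms by (auto intro: poly_mapping_eqI)

text \<open>By \<open>ker_diag\<close> a diagonal generator is determined by its weight up to a
  scalar, so two of equal weight would contradict minimality. Conversely every vertex of the next
  level occurs, since otherwise a proper submodule of the kernel would contain all
  generators.\<close>

lemma level_basis_step:
  assumes B: "level_basis n t u"
  shows "\<exists>t'. level_basis (Suc n) t' (\<lambda>j. 1 / t j)"
proof -
  let ?wt = "wt (R (Suc n))"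
  have t: "t j \<noteq> 0" if "j \<in> diag n" for j using B that by (auto simp: level_basis_def)
  have bij: "bij_betw (wt (R n)) (diag n) (L n)" using B by (auto simp: level_basis_def)
  have dg: "int (Suc n) \<le> dg (R (Suc n)) j" if j: "j \<in> idx (R (Suc n))" for j
  proof (rule ccontr)
    assume "\<not> ?thesis"
    then have "gen (Suc n) j = 0"
      using ker_low_degree[OF B gen_component(2)[OF j] gen_ker[OF j] gen_component(1)[OF j]] by simp
    with gen_nonzero[OF j] show False by simp
  qed
  have "\<exists>c. c \<noteq> 0 \<and> ?wt j \<in> L (Suc n) \<and> (\<forall>k. Poly_Mapping.lookup (gen (Suc n) j) k =
      (if k \<in> diag n then scl (c / t k) (?wt j) * arr (wt (R n) k) (?wt j) else 0))"
    if j: "j \<in> diag (Suc n)" for j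
  proof -
    have j': "j \<in> idx (R (Suc n))" "gen (Suc n) j \<in> component (R n) (?wt j) (int (Suc n))"
      using j gen_component(1)[of j n] by (auto simp: diag_def)
    from ker_diag[OF B gen_component(2)[OF j'(1)] gen_ker[OF j'(1)] j'(2)]
    obtain c where c: "?wt j \<notin> L (Suc n) \<longrightarrow> c = 0" "\<And>k. Poly_Mapping.lookup (gen (Suc n) j) k =
      (if k \<in> diag n then scl (c / t k) (?wt j) * arr (wt (R n) k) (?wt j) else 0)" by blast
    have "c \<noteq> 0" using scl_div_arr_eq_0[of "gen (Suc n) j", OF c(2) gen_nonzero[OF j'(1)]] .
    with c show ?thesis by blast
  qed
  then obtain t' where t': "\<And>j. j \<in> diag (Suc n) \<Longrightarrow> t' j \<noteq> 0"
    "\<And>j. j \<in> diag (Suc n) \<Longrightarrow> ?wt j \<in> L (Suc n)"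
    "\<And>j k. j \<in> diag (Suc n) \<Longrightarrow> Poly_Mapping.lookup (gen (Suc n) j) k =
      (if k \<in> diag n then scl (t' j / t k) (?wt j) * arr (wt (R n) k) (?wt j) else 0)"
    by metis
  have inj: "inj_on ?wt (diag (Suc n))"
  proof (rule inj_onI, rule ccontr)
    fix j k assume jk: "j \<in> diag (Suc n)" "k \<in> diag (Suc n)" "?wt j = ?wt k" "j \<noteq> k"
    have "gen (Suc n) j = act (scl (t' j / t' k) (?wt j)) (gen (Suc n) k)"
      using t'(1)[OF jk(1)] t'(1)[OF jk(2)] jk(3)
      by (intro poly_mapping_eqI) (simp add: lookup_act t'(3)[OF jk(1)] t'(3)[OF jk(2)] scl_mult_left)
    moreover have "gen (Suc n) k \<in> generated (gen (Suc n) ` (idx (R (Suc n)) - {j}))"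
      using jk by (intro generated_base) (auto simp: diag_def)
    ultimately have "gen (Suc n) j \<in> generated (gen (Suc n) ` (idx (R (Suc n)) - {j}))"
      by (metis generated_act)
    with gen_not_redundant[of j n] jk(1) show False by (auto simp: diag_def)
  qed
  have "v \<in> ?wt ` diag (Suc n)" if v: "v \<in> L (Suc n)" for v
  proof (rule ccontr)
    assume nv: "v \<notin> ?wt ` diag (Suc n)"
    obtain x where x: "x \<in> ker_phi \<mu> R gen n" "\<And>j. Poly_Mapping.lookup x j =
        (if j \<in> diag n then scl (1 / t j) v * arr (wt (R n) j) v else 0)"
      using ker_diag_exists[OF B v] by blast
    obtain \<nu> where \<nu>: "\<nu> \<in> L n" "edge \<nu> v" using level_pred[OF v] by blast
    then obtain j where j: "j \<in> diag n" "wt (R n) j = \<nu>"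
      using bij_betw_imp_surj_on[OF bij] by (metis imageE)
    let ?p = "arr_path \<nu> v"
    note p = arr_path[OF \<nu>(2) level_Lambda_odd[OF \<nu>(1)]]
    \<comment> \<open>If no diagonal generator has weight v, this submodule contains every
      generator: those of degree n + 1 have another target, the others have entries of degree at
      least two at \<open>j\<close>. It misses x, which has a nonzero coefficient at the arrow. The
      condition in degree zero makes it stable under the action.\<close>
    define N where "N = {y. (\<forall>q. plen q = 0 \<longrightarrow> coeff q (Poly_Mapping.lookup y j) = 0) \<and>
      coeff ?p (Poly_Mapping.lookup y j) = 0}"
    have "generated (gen (Suc n) ` idx (R (Suc n))) \<subseteq> N"
    proof (rule generated_least)
      show "gen (Suc n) ` idx (R (Suc n)) \<subseteq> N"
      proof
        fix y assume "y \<in> gen (Suc n) ` idx (R (Suc n))"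
        then obtain k where k: "k \<in> idx (R (Suc n))" "y = gen (Suc n) k" by blast
        note c = componentD[OF gen_component(1)[OF k(1)]]
        have d: "Poly_Mapping.lookup y j \<in> alg_degree (dg (R (Suc n)) k - int n)"
          using c(5)[of j] j(1) k(2) by (simp add: diag_def)
        have "coeff ?p (Poly_Mapping.lookup y j) = 0"
        proof (cases "dg (R (Suc n)) k = int (Suc n)")
          case True
          then have "?wt k \<noteq> v" using nv k(1) by (auto simp: diag_def)
          then show ?thesis
            using coeff_other_target[OF c(1)[of j], of ?p] p(2) k(2) by simp
        next
          case False
          then show ?thesis using coeff_alg_degree[OF d, of ?p] p(1) by simp
        qed
        moreover have "coeff q (Poly_Mapping.lookup y j) = 0" if "plen q = 0" for q
          using coeff_alg_degree[OF d, of q] that dg[OF k(1)] by simp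
        ultimately show "y \<in> N" by (simp add: N_def)
      qed
    qed (auto simp: N_def lookup_minus coeff_diff lookup_act coeff_mult_left)
    then have "x \<in> N" using x(1) generated_gen by blast
    then have "coeff ?p (scl (1 / t j) v * arr \<nu> v) = 0"
      using x(2)[of j] j by (simp add: N_def)
    then have "scal (link \<nu> v) \<nu> = 0" using p(3)[of "1 / t j"] t[OF j(1)] by simp
    with \<nu>(2) scal_nonzero show False by (auto simp: edge_def)
  qed
  with inj t'(2) have "bij_betw ?wt (diag (Suc n)) (L (Suc n))"
    by (auto simp: bij_betw_def)
  then have "level_basis (Suc n) t' (\<lambda>j. 1 / t j)"
    unfolding level_basis_def using dg t' t bij by auto
  then show ?thesis by blast
qed

lemma level_basis_0: "level_basis 0 (\<lambda>_. 1) u"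
proof -
  obtain j where "idx (R 0) = {j}" "wt (R 0) j = \<mu>" "dg (R 0) j = 0" by (rule idx_0)
  then show ?thesis by (auto simp: level_basis_def diag_def level_0 bij_betw_def inj_on_def)
qed

lemma ex_level_basis: "\<exists>t u. level_basis n t u"
  by (induction n) (use level_basis_0 level_basis_step in blast)+

lemma N_mult_eq: "N_mult R n v = (if v \<in> L n then 1 else 0)"
proof -
  obtain t u where "level_basis n t u" using ex_level_basis by blast
  then have bij: "bij_betw (wt (R n)) (diag n) (L n)" by (simp add: level_basis_def)
  define J where "J = {j \<in> diag n. wt (R n) j = v}"
  have "N_mult R n v = (if finite J then enat (card J) else \<infinity>)"
    unfolding N_mult_def multiplicity_def Let_def linear_part_def J_def diag_def
    by (auto intro!: arg_cong[of _ _ card] arg_cong[of _ _ finite] simp: conj_ac)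
  also have "\<dots> = (if v \<in> L n then 1 else 0)"
  proof (cases "v \<in> L n")
    case True
    then obtain j where "j \<in> diag n" "wt (R n) j = v" using bij_betw_imp_surj_on[OF bij] by (metis imageE)
    then have "J = {j}" using bij by (auto simp: J_def bij_betw_def inj_on_def)
    then show ?thesis using True by (simp add: one_enat_def)
  next
    case False
    then have "J = {}" using bij by (auto simp: J_def bij_betw_def)
    then show ?thesis using False by (simp add: zero_enat_def)
  qed
  finally show ?thesis .
qed

end

section \<open>The levels\<close>

text \<open>Vertices are parametrised by the numbers \<open>i\<close>, \<open>j\<close>, \<open>k\<close> of letters \<open>f, f'\<close>, of letters
  \<open>g, g'\<close> and of letters \<open>p, q\<close> of a path from \<open>\<mu>\<close>; the parity of \<open>k + s\<close> tells whether the vertex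
  has the form \<open>(\<alpha>, \<beta>)\<close> or \<open>(-\<alpha>-2, \<beta>)\<close>.\<close>

definition grid :: "int \<Rightarrow> int \<Rightarrow> int \<Rightarrow> int \<Rightarrow> int \<Rightarrow> int \<Rightarrow> weight" where
  "grid A b s i j k =
    (if odd (k + s) then - (A + 2 * i - 2 * j) - 2 else A + 2 * i - 2 * j, b + i + j)"

text \<open>The second coordinate gives i + j, the fixed length then gives k, and the parity of k
  lets the first coordinate give i - j. The length has to be fixed because k enters the vertex only
  through its parity.\<close>

lemma grid_inject:
  assumes "grid A b s i j k = grid A b s i' j' k'" "i + j + k = i' + j' + k'"
  shows "i = i' \<and> j = j' \<and> k = k'"
proof -
  have "i + j = i' + j'" using assms(1) by (auto simp: grid_def)
  with assms(2) have "k = k'" by simp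
  then show ?thesis using assms(1) \<open>i + j = i' + j'\<close> by (auto simp: grid_def split: if_splits)
qed

text \<open>With \<alpha> = A + 2i - 2j, the letters f, f' raise \<alpha> by 2, g, g' lower it by 2,
  and p, q change only the half. At \<alpha> = -1 the two forms of the vertex coincide; its only
  outgoing arrow is f', so it has to be read in the form with k + s odd.\<close>

lemma edge_grid:
  assumes "A + 2 * i - 2 * j \<ge> 1 \<or> A + 2 * i - 2 * j = -1 \<and> odd (k + s)"
  shows "edge (grid A b s i j k) v \<longleftrightarrow> v = grid A b s (i + 1) j k \<or>
    A + 2 * i - 2 * j \<ge> 1 \<and> (v = grid A b s i j (k + 1) \<or>
      (odd (k + s) \<or> A + 2 * i - 2 * j \<ge> 3) \<and> v = grid A b s i (j + 1) k)"
proof -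
  define \<alpha> \<beta> where "\<alpha> = A + 2 * i - 2 * j" and "\<beta> = b + i + j"
  have g: "grid A b s i j k = (if odd (k + s) then - \<alpha> - 2 else \<alpha>, \<beta>)"
    "grid A b s (i + 1) j k = (if odd (k + s) then - \<alpha> - 4 else \<alpha> + 2, \<beta> + 1)"
    "grid A b s i (j + 1) k = (if odd (k + s) then - \<alpha> else \<alpha> - 2, \<beta> + 1)"
    "grid A b s i j (k + 1) = (if odd (k + s) then \<alpha> else - \<alpha> - 2, \<beta>)"
    by (simp_all add: grid_def \<alpha>_def \<beta>_def)
  have "\<alpha> \<ge> 1 \<or> \<alpha> = -1 \<and> odd (k + s)" using assms by (simp add: \<alpha>_def)
  then show ?thesis unfolding g \<alpha>_def[symmetric]
    by (cases "odd (k + s)") (auto simp: edge_iff)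
qed

lemma edge_grid_cases:
  assumes "A + 2 * i - 2 * j \<ge> 1 \<or> A + 2 * i - 2 * j = -1 \<and> odd (k + s)"
    and "edge (grid A b s i j k) (grid A b s i' j' k')" "i' + j' + k' = i + j + k + 1"
  shows "i' = i + 1 \<and> j' = j \<and> k' = k \<or> i' = i \<and> j' = j + 1 \<and> k' = k \<or>
    i' = i \<and> j' = j \<and> k' = k + 1"
proof -
  have sums: "i' + j' + k' = i + 1 + j + k" "i' + j' + k' = i + (j + 1) + k"
    "i' + j' + k' = i + j + (k + 1)" using assms(3) by simp_all
  from assms(2) show ?thesis
    unfolding edge_grid[OF assms(1)] using sums[THEN grid_inject[rotated]] by blast
qed

section \<open>Levels as slices of a domain in the grid\<close>

definition level_set ::
  "(int \<Rightarrow> int \<Rightarrow> int \<Rightarrow> bool) \<Rightarrow> int \<Rightarrow> int \<Rightarrow> int \<Rightarrow> nat \<Rightarrow> weight set" where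
  "level_set D A b s n = {grid A b s i j k | i j k. D i j k \<and> i + j + k = int n}"

lemma level_setE:
  assumes "v \<in> level_set D A b s n"
  obtains i j k where "v = grid A b s i j k" "D i j k" "i + j + k = int n"
  using assms by (auto simp: level_set_def)

lemma grid_in_level_set:
  assumes "i + j + k = int n"
  shows "grid A b s i j k \<in> level_set D A b s n \<longleftrightarrow> D i j k"
proof
  assume "grid A b s i j k \<in> level_set D A b s n"
  then obtain i' j' k' where e: "grid A b s i j k = grid A b s i' j' k'" "D i' j' k'"
    "i' + j' + k' = int n" by (rule level_setE)
  have "i + j + k = i' + j' + k'" using e(3) assms by simp
  with grid_inject[OF e(1)] e(2) show "D i j k" by simp
next
  assume "D i j k"
  with assms show "grid A b s i j k \<in> level_set D A b s n" unfolding level_set_def by blast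
qed

text \<open>A third letter p or q would complete the free path pq. For 2j + 1 = a and \<alpha> = 1 a
  further g or g' is no arrow or completes g'p, after one more f it may complete gf, and the squares
  with f carry the obstruction to larger i.\<close>

definition domain_pos :: "int \<Rightarrow> int \<Rightarrow> int \<Rightarrow> int \<Rightarrow> bool" where
  "domain_pos a i j k \<longleftrightarrow> 0 \<le> i \<and> 0 \<le> j \<and> 0 \<le> k \<and> k \<le> 2 \<and> 2 * j + 1 \<le> a"

text \<open>Here already k = 2 would complete pq. For k = 0 the only limit is the wall \<alpha> =
  -1, where g' ends. For 2j + 1 > A, entering k = 1 is blocked by the free path qf' at \<alpha> =
  -1, and squares carry this obstruction to larger i.\<close>

definition domain_neg :: "int \<Rightarrow> int \<Rightarrow> int \<Rightarrow> int \<Rightarrow> bool" where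
  "domain_neg A i j k \<longleftrightarrow> 0 \<le> i \<and> 0 \<le> j \<and>
    (k = 0 \<and> -1 \<le> A + 2 * i - 2 * j \<or> k = 1 \<and> 2 * j + 1 \<le> A)"

definition domain :: "int \<Rightarrow> int \<Rightarrow> int \<Rightarrow> int \<Rightarrow> int \<Rightarrow> bool" where
  "domain A s = (if s = 0 then domain_pos A else domain_neg A)"

definition level :: "int \<Rightarrow> int \<Rightarrow> int \<Rightarrow> nat \<Rightarrow> weight set" where
  "level A b s = level_set (domain A s) A b s"

text \<open>The value s = 0 puts \<mu> at (A, b), with A = a \<ge> 1; the value s = 1 puts \<mu> at
  (-A-2, b), with A = -a-2 \<ge> -1.\<close>

context
  fixes A b s :: int
  assumes A: "odd A" and s: "s = 0 \<and> A \<ge> 1 \<or> s = 1 \<and> A \<ge> -1"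
begin

abbreviation "G \<equiv> grid A b s"
abbreviation "D \<equiv> domain A s"
abbreviation "LL \<equiv> level A b s"

lemma D_cases:
  assumes "D i j k"
  shows "A + 2 * i - 2 * j \<ge> 1 \<or> A + 2 * i - 2 * j = -1 \<and> odd (k + s) \<and> k = 0"
proof -
  have "odd (A + 2 * i - 2 * j)" using A by simp
  then have "A + 2 * i - 2 * j \<noteq> 0" by (metis even_zero)
  with assms s show ?thesis
    by (auto simp: domain_def domain_pos_def domain_neg_def)
qed

lemma D_step:
  assumes "D i j k"
  shows "edge (G i j k) v \<longleftrightarrow> v = G (i + 1) j k \<or>
    A + 2 * i - 2 * j \<ge> 1 \<and> (v = G i j (k + 1) \<or>
      (odd (k + s) \<or> A + 2 * i - 2 * j \<ge> 3) \<and> v = G i (j + 1) k)"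
  using D_cases[OF assms] by (intro edge_grid) auto

lemma mem_level: "i + j + k = int n \<Longrightarrow> G i j k \<in> LL n \<longleftrightarrow> D i j k"
  by (simp add: level_def grid_in_level_set)

lemma levelE:
  assumes "v \<in> LL n"
  obtains i j k where "v = G i j k" "D i j k" "i + j + k = int n"
  using assms unfolding level_def by (rule level_setE)

lemma D_pred_edges:
  "D (i - 1) j k \<Longrightarrow> edge (G (i - 1) j k) (G i j k)"
  "D i (j - 1) k \<Longrightarrow> D i j k \<Longrightarrow> edge (G i (j - 1) k) (G i j k)"
  "D i j (k - 1) \<Longrightarrow> D i j k \<Longrightarrow> edge (G i j (k - 1)) (G i j k)"
  using s by (auto simp: D_step domain_def domain_pos_def domain_neg_def)

lemma level_grid_0: "LL 0 = {G 0 0 0}"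
proof -
  have "D i j k \<and> i + j + k = 0 \<longleftrightarrow> i = 0 \<and> j = 0 \<and> k = 0" for i j k
    using s by (auto simp: domain_def domain_pos_def domain_neg_def)
  then show ?thesis unfolding level_def level_set_def by simp
qed

lemma D_0: "D 0 0 0"
  using s by (auto simp: domain_def domain_pos_def domain_neg_def)

lemma level_grid_1: "v \<in> LL 1 \<longleftrightarrow> edge (G 0 0 0) v"
proof -
  have "D 1 0 0" "D 0 0 1 \<longleftrightarrow> A \<ge> 1" "D 0 1 0 \<longleftrightarrow> A \<ge> 1 \<and> (odd s \<or> A \<ge> 3)"
    using s by (auto simp: domain_def domain_pos_def domain_neg_def)
  then have e: "edge (G 0 0 0) v \<longleftrightarrow> v = G 1 0 0 \<and> D 1 0 0 \<or> v = G 0 0 1 \<and> D 0 0 1 \<or> v = G 0 1 0 \<and> D 0 1 0"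
    by (auto simp: D_step[OF D_0])
  show ?thesis
  proof
    assume "v \<in> LL 1"
    then obtain i j k where v: "v = G i j k" "D i j k" "i + j + k = 1" by (auto elim: levelE)
    have "0 \<le> i" "0 \<le> j" "0 \<le> k" using v(2) by (auto simp: domain_def domain_pos_def domain_neg_def split: if_splits)
    with v(3) have "i = 1 \<and> j = 0 \<and> k = 0 \<or> i = 0 \<and> j = 1 \<and> k = 0 \<or> i = 0 \<and> j = 0 \<and> k = 1" by linarith
    with v show "edge (G 0 0 0) v" unfolding e by blast
  next
    assume "edge (G 0 0 0) v"
    then show "v \<in> LL 1" unfolding e by (auto simp: mem_level)
  qed
qed

text \<open>Lowering k, or j when k = 0, stays inside the domain, whereas lowering i may cross the
  wall \<alpha> = -1; i is therefore lowered only when j = k = 0.\<close>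

lemma D_ex_pred:
  assumes "D i j k" "i + j + k \<ge> 1"
  shows "D (i - 1) j k \<or> D i (j - 1) k \<or> D i j (k - 1)"
proof -
  have "0 \<le> i" "0 \<le> j" "0 \<le> k"
    using assms(1) by (auto simp: domain_def domain_pos_def domain_neg_def split: if_splits)
  with assms(2) consider "k \<ge> 1" | "k = 0" "j \<ge> 1" | "k = 0" "j = 0" "i \<ge> 1" by linarith
  then show ?thesis
  proof cases
    case 1
    then have "D i j (k - 1)"
      using assms(1) s by (auto simp: domain_def domain_pos_def domain_neg_def)
    then show ?thesis by simp
  next
    case 2
    then have "D i (j - 1) k"
      using assms(1) s by (auto simp: domain_def domain_pos_def domain_neg_def)
    then show ?thesis by simp
  next
    case 3
    then have "D (i - 1) j k"
      using assms(1) s by (auto simp: domain_def domain_pos_def domain_neg_def)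
    then show ?thesis by simp
  qed
qed

lemma level_grid_pred:
  assumes "v \<in> LL (Suc n)"
  shows "\<exists>\<nu>\<in>LL n. edge \<nu> v"
proof -
  obtain i j k where v: "v = G i j k" "D i j k" "i + j + k = int (Suc n)" using assms by (rule levelE)
  then consider "D (i - 1) j k" | "D i (j - 1) k" | "D i j (k - 1)" using D_ex_pred[OF v(2)] by auto
  then show ?thesis
  proof cases
    case 1
    with v D_pred_edges(1)[OF 1] show ?thesis by (intro bexI[of _ "G (i - 1) j k"]) (auto simp: mem_level)
  next
    case 2
    with v D_pred_edges(2)[OF 2] show ?thesis by (intro bexI[of _ "G i (j - 1) k"]) (auto simp: mem_level)
  next
    case 3
    with v D_pred_edges(3)[OF 3] show ?thesis by (intro bexI[of _ "G i j (k - 1)"]) (auto simp: mem_level)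
  qed
qed

text \<open>The path pq would end at k = 3 for s = 0 and at k = 2 for s = 1. The paths gf and g'p
  start at \<alpha> = 1 with k + s even, where A = 2j + 1 and one more g leaves the domain. The path
  qf' starts at \<alpha> = -1, where A < 2j + 1 excludes k = 1.\<close>

lemma D_not_free:
  assumes "D i j k" "D i' j' k'" "i' + j' + k' = i + j + k + 2"
  shows "\<not> free_pair (G i j k) (G i' j' k')"
proof
  assume f: "free_pair (G i j k) (G i' j' k')"
  show False
  proof (cases "s = 0")
    case True
    with assms(1,2) have "k = 0 \<or> k = 1 \<or> k = 2" "k' = 0 \<or> k' = 1 \<or> k' = 2"
      by (auto simp: domain_def domain_pos_def)
    then show False
      using f assms True by (elim disjE) (auto simp: grid_def free_pair_def domain_def domain_pos_def)
  next
    case False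
    with assms(1,2) s have "k = 0 \<or> k = 1" "k' = 0 \<or> k' = 1" "s = 1"
      by (auto simp: domain_def domain_neg_def)
    then show False
      using f assms by (elim disjE) (auto simp: grid_def free_pair_def domain_def domain_neg_def)
  qed
qed

text \<open>Raising i never leaves the domain. Otherwise the bounds at the end point give those at
  the middle, because the bound on j does not involve i, except for s = 1 and k = 0, where the
  existence of the arrow g' suffices.\<close>

lemma D_between:
  assumes "D i j k" "D i'' j'' k''" "edge (G i j k) \<nu>" "edge \<nu> (G i'' j'' k'')"
    "i'' + j'' + k'' = i + j + k + 2"
  shows "\<exists>i' j' k'. \<nu> = G i' j' k' \<and> D i' j' k' \<and> i' + j' + k' = i + j + k + 1"
proof -
  from D_step[OF assms(1)] assms(3) consider "\<nu> = G (i + 1) j k"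
    | "A + 2 * i - 2 * j \<ge> 1" "\<nu> = G i j (k + 1)"
    | "A + 2 * i - 2 * j \<ge> 1" "odd (k + s) \<or> A + 2 * i - 2 * j \<ge> 3" "\<nu> = G i (j + 1) k" by blast
  then show ?thesis
  proof cases
    case 1
    then show ?thesis
      using assms(1) s by (intro exI[of _ "i + 1"] exI[of _ j] exI[of _ k])
        (auto simp: domain_def domain_pos_def domain_neg_def)
  next
    case 2
    have "A + 2 * i - 2 * j \<ge> 1 \<or> A + 2 * i - 2 * j = -1 \<and> odd (k + 1 + s)" using 2 by simp
    from edge_grid_cases[OF this assms(4)[unfolded 2(2)]] assms(5)
    have "i'' = i + 1 \<and> j'' = j \<and> k'' = k + 1 \<or> i'' = i \<and> j'' = j + 1 \<and> k'' = k + 1 \<or>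
      i'' = i \<and> j'' = j \<and> k'' = k + 2" by auto
    then have "D i j (k + 1)"
      using assms(1,2) s by (auto simp: domain_def domain_pos_def domain_neg_def)
    then show ?thesis using 2 by (intro exI[of _ i] exI[of _ j] exI[of _ "k + 1"]) auto
  next
    case 3
    have "odd (A + 2 * i - 2 * (j + 1))" using A by simp
    then have "A + 2 * i - 2 * (j + 1) \<noteq> 0" by (metis even_zero)
    then have "A + 2 * i - 2 * (j + 1) \<ge> 1 \<or> A + 2 * i - 2 * (j + 1) = -1 \<and> odd (k + s)" using 3(1,2) by auto
    from edge_grid_cases[OF this assms(4)[unfolded 3(3)]] assms(5)
    have "i'' = i + 1 \<and> j'' = j + 1 \<and> k'' = k \<or> i'' = i \<and> j'' = j + 2 \<and> k'' = k \<or>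
      i'' = i \<and> j'' = j + 1 \<and> k'' = k + 1" by auto
    then have "D i (j + 1) k"
      using assms(1,2) 3 s by (auto simp: domain_def domain_pos_def domain_neg_def)
    then show ?thesis using 3 by (intro exI[of _ i] exI[of _ "j + 1"] exI[of _ k]) auto
  qed
qed

lemma level_grid_mids:
  assumes "v \<in> LL (Suc (Suc n))" "\<rho> \<in> LL n"
  shows "\<not> free_pair \<rho> v \<and> mids \<rho> v \<subseteq> LL (Suc n)"
proof -
  obtain i j k where \<rho>: "\<rho> = G i j k" "D i j k" "i + j + k = int n" using assms(2) by (rule levelE)
  obtain i' j' k' where v: "v = G i' j' k'" "D i' j' k'" "i' + j' + k' = int (Suc (Suc n))"
    using assms(1) by (rule levelE)
  have "i' + j' + k' = i + j + k + 2" using \<rho>(3) v(3) by simp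
  then show ?thesis
    using D_not_free[OF \<rho>(2) v(2)] D_between[OF \<rho>(2) v(2)] \<rho> v
    by (fastforce simp: mids_def mem_level)
qed

lemma D_edge_cases:
  assumes "D i j k" "edge (G i j k) (G i' j' k')" "i' + j' + k' = i + j + k + 1"
  shows "i' = i + 1 \<and> j' = j \<and> k' = k \<or> i' = i \<and> j' = j + 1 \<and> k' = k \<or> i' = i \<and> j' = j \<and> k' = k + 1"
  using D_cases[OF assms(1)] assms(2,3) by (intro edge_grid_cases) auto

lemma D_common_pred:
  "D (i - 1) j k \<Longrightarrow> D i (j - 1) k \<Longrightarrow> D i j k \<Longrightarrow> D (i - 1) (j - 1) k"
  "D (i - 1) j k \<Longrightarrow> D i j (k - 1) \<Longrightarrow> D i j k \<Longrightarrow> D (i - 1) j (k - 1)"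
  "D i (j - 1) k \<Longrightarrow> D i j (k - 1) \<Longrightarrow> D i j k \<Longrightarrow> D i (j - 1) (k - 1)"
  using s by (auto simp: domain_def domain_pos_def domain_neg_def)

text \<open>A predecessor of v arises by lowering one of i, j, k; two different ones share the
  vertex where both are lowered, which \<open>D_common_pred\<close> keeps in the domain.\<close>

lemma level_grid_connected:
  assumes "v \<in> LL (Suc (Suc n))" "\<nu> \<in> LL (Suc n)" "\<nu>' \<in> LL (Suc n)"
    "edge \<nu> v" "edge \<nu>' v" "\<nu> \<noteq> \<nu>'"
  shows "\<exists>\<rho>\<in>LL n. edge \<rho> \<nu> \<and> edge \<rho> \<nu>'"
proof -
  obtain i j k where v: "v = G i j k" "D i j k" "i + j + k = int (Suc (Suc n))"
    using assms(1) by (rule levelE)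
  have p: "\<nu> = G (i - 1) j k \<and> D (i - 1) j k \<or> \<nu> = G i (j - 1) k \<and> D i (j - 1) k \<or>
      \<nu> = G i j (k - 1) \<and> D i j (k - 1)" if m: "\<nu> \<in> LL (Suc n)" "edge \<nu> v" for \<nu>
  proof -
    obtain i' j' k' where \<nu>: "\<nu> = G i' j' k'" "D i' j' k'" "i' + j' + k' = int (Suc n)"
      using m(1) by (rule levelE)
    have "i = i' + 1 \<and> j = j' \<and> k = k' \<or> i = i' \<and> j = j' + 1 \<and> k = k' \<or> i = i' \<and> j = j' \<and> k = k' + 1"
      using m(2) \<nu>(3) v(3) unfolding \<nu>(1) v(1) by (intro D_edge_cases[OF \<nu>(2)]) auto
    then show ?thesis using \<nu> by auto
  qed
  have 1: ?thesis if "D (i - 1) j k" "D i (j - 1) k" "\<nu> = G (i - 1) j k \<and> \<nu>' = G i (j - 1) k \<or> \<nu> = G i (j - 1) k \<and> \<nu>' = G (i - 1) j k"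
  proof (rule bexI)
    have d: "D (i - 1) (j - 1) k" using D_common_pred(1) that v(2) by blast
    then show "G (i - 1) (j - 1) k \<in> LL n" using v(3) by (simp add: mem_level)
    show "edge (G (i - 1) (j - 1) k) \<nu> \<and> edge (G (i - 1) (j - 1) k) \<nu>'"
      using that(3) D_pred_edges(1)[of i "j - 1" k, OF d] D_pred_edges(2)[OF d that(1)] by auto
  qed
  have 2: ?thesis if "D (i - 1) j k" "D i j (k - 1)" "\<nu> = G (i - 1) j k \<and> \<nu>' = G i j (k - 1) \<or> \<nu> = G i j (k - 1) \<and> \<nu>' = G (i - 1) j k"
  proof (rule bexI)
    have d: "D (i - 1) j (k - 1)" using D_common_pred(2) that v(2) by blast
    then show "G (i - 1) j (k - 1) \<in> LL n" using v(3) by (simp add: mem_level)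
    show "edge (G (i - 1) j (k - 1)) \<nu> \<and> edge (G (i - 1) j (k - 1)) \<nu>'"
      using that(3) D_pred_edges(1)[of i j "k - 1", OF d] D_pred_edges(3)[OF d that(1)] by auto
  qed
  have 3: ?thesis if "D i (j - 1) k" "D i j (k - 1)" "\<nu> = G i (j - 1) k \<and> \<nu>' = G i j (k - 1) \<or> \<nu> = G i j (k - 1) \<and> \<nu>' = G i (j - 1) k"
  proof (rule bexI)
    have d: "D i (j - 1) (k - 1)" using D_common_pred(3) that v(2) by blast
    then show "G i (j - 1) (k - 1) \<in> LL n" using v(3) by (simp add: mem_level)
    show "edge (G i (j - 1) (k - 1)) \<nu> \<and> edge (G i (j - 1) (k - 1)) \<nu>'"
      using that(3) D_pred_edges(2)[OF d that(2)] D_pred_edges(3)[OF d that(1)] by auto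
  qed
  have "\<not> (\<nu> = w \<and> \<nu>' = w)" for w using assms(6) by blast
  from this[of "G (i - 1) j k"] this[of "G i (j - 1) k"] this[of "G i j (k - 1)"]
    p[OF assms(2,4)] p[OF assms(3,5)] 1 2 3
  show ?thesis by argo
qed

text \<open>Dropping a letter of \<nu> produces the obstruction: either that letter and the step to
  v form a free path, or exchanging the two passes through a vertex outside the domain.\<close>

lemma level_grid_obstructed:
  assumes v: "v \<notin> LL (Suc (Suc n))" and \<nu>: "\<nu> \<in> LL (Suc n)" and e: "edge \<nu> v"
  shows "\<exists>\<rho>\<in>LL n. edge \<rho> \<nu> \<and> (free_pair \<rho> v \<or> \<not> mids \<rho> v \<subseteq> LL (Suc n))"
proof -
  obtain i j k where x: "\<nu> = G i j k" "D i j k" "i + j + k = int (Suc n)" using \<nu> by (rule levelE)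
  let ?\<alpha> = "A + 2 * i - 2 * j"
  have up: "\<not> D i' j' k'" if "v = G i' j' k'" "i' + j' + k' = i + j + k + 1" for i' j' k'
    using v x(3) that mem_level[of i' j' k' "Suc (Suc n)"] by auto
  \<comment> \<open>The last letter f is exchanged with the step to v; \<nu>' is the other corner of
    the square and lies outside the level.\<close>
  have i1: ?thesis if i: "i \<ge> 1" "D (i - 1) j k" "\<nu>' = G (i - 1) j' k'" "j' + k' = j + k + 1"
      "\<not> D (i - 1) j' k'" "edge (G (i - 1) j k) \<nu>'" "edge \<nu>' v" for \<nu>' j' k'
  proof (intro bexI conjI disjI2)
    show "G (i - 1) j k \<in> LL n" using i x(3) by (simp add: mem_level)
    show "edge (G (i - 1) j k) \<nu>" unfolding x(1) by (rule D_pred_edges(1)[OF i(2)])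
    have "\<nu>' \<notin> LL (Suc n)" unfolding i(3) using i(4,5) x(3) by (subst mem_level) auto
    then show "\<not> mids (G (i - 1) j k) v \<subseteq> LL (Suc n)" using i(6,7) by (auto simp: mids_def)
  qed
  have i2: ?thesis if "D (i - 1) j k" "free_pair (G (i - 1) j k) v"
    using that x D_pred_edges(1)[OF that(1)] by (intro bexI[of _ "G (i - 1) j k"]) (auto simp: mem_level)
  have i3: ?thesis if "D i j (k - 1)" "free_pair (G i j (k - 1)) v"
    using that x D_pred_edges(3)[OF that(1) x(2)] by (intro bexI[of _ "G i j (k - 1)"]) (auto simp: mem_level)
  from D_step[OF x(2)] e x(1) consider "v = G (i + 1) j k"
    | "?\<alpha> \<ge> 1" "v = G i j (k + 1)"
    | "?\<alpha> \<ge> 1" "odd (k + s) \<or> ?\<alpha> \<ge> 3" "v = G i (j + 1) k" by blast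
  then show ?thesis
  proof cases
    case 1
    have "D (i + 1) j k" using x(2) s by (auto simp: domain_def domain_pos_def domain_neg_def)
    with up[OF 1] show ?thesis by simp
  next
    case 2
    have nD: "\<not> D i j (k + 1)" using up[OF 2(2)] by simp
    show ?thesis
    proof (cases "D i j (k - 1)")
      case True
      \<comment> \<open>Here k is maximal, and one more letter completes pq.\<close>
      moreover have "s = 0 \<and> k = 2 \<or> s = 1 \<and> k = 1"
        using nD True x(2) s by (auto simp: domain_def domain_pos_def domain_neg_def)
      then have "free_pair (G i j (k - 1)) v"
        using 2 by (elim disjE) (auto simp: free_pair_def grid_def)
      ultimately show ?thesis by (rule i3)
    next
      case False
      then have k: "k = 0" "s = 1" "A < 2 * j + 1" "0 \<le> i" "0 \<le> j"
        using nD x(2) 2(1) s by (auto simp: domain_def domain_pos_def domain_neg_def)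
      then have i: "i \<ge> 1" "D (i - 1) j k"
        using 2(1) by (auto simp: domain_def domain_neg_def)
      show ?thesis
      proof (cases "?\<alpha> \<ge> 3")
        case True
        then show ?thesis using i k 2
          by (intro i1[of "G (i - 1) j (k + 1)" j "k + 1"])
             (auto simp: domain_def domain_neg_def D_step[OF i(2)] edge_grid)
      next
        case False
        moreover have "odd ?\<alpha>" using A by simp
        then have "?\<alpha> \<noteq> 2" by (metis even_numeral)
        ultimately have "?\<alpha> = 1" using 2(1) by linarith
        \<comment> \<open>Without its last f' the vertex lies at \<alpha> = -1, and f' followed by q
          is free there.\<close>
        then have "free_pair (G (i - 1) j k) v"
          unfolding 2(2) by (auto simp: k(1,2) free_pair_def grid_def)
        then show ?thesis by (rule i2[OF i(2)])
      qed
    qed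
  next
    case 3
    have "\<not> D i (j + 1) k" using up[OF 3(3)] by simp
    then have j: "2 * j + 1 \<le> A" "A < 2 * j + 3" "0 \<le> i" "0 \<le> j" "s = 0 \<or> k = 1" "s = 0 \<or> s = 1"
        "0 \<le> k" "k \<le> 2"
      using x(2) 3(1,2) s by (auto simp: domain_def domain_pos_def domain_neg_def)
    then have "A \<noteq> 2 * j + 2" using A by auto
    then have Aj: "A = 2 * j + 1" using j by linarith
    show ?thesis
    proof (cases "i = 0")
      case True
      \<comment> \<open>For i = 0 the vertex is at \<alpha> = 1, where only g' lowers \<alpha>; so k
        + s is odd, and p followed by g' is free.\<close>
      then have k: "k = 1" "s = 0" using 3(2) j Aj by (auto, presburger?)
      have "D i j (k - 1)" "free_pair (G i j (k - 1)) v"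
        using k j Aj True by (auto simp: domain_def domain_pos_def 3(3) free_pair_def grid_def)
      then show ?thesis by (rule i3)
    next
      case False
      then have i: "i \<ge> 1" "D (i - 1) j k"
        using j x(2) by (auto simp: domain_def domain_pos_def domain_neg_def)
      show ?thesis
      proof (cases "i = 1 \<and> even (k + s)")
        case True
        \<comment> \<open>Without its last f the vertex is at \<alpha> = 1, where f followed by g is
          free.\<close>
        then have "free_pair (G (i - 1) j k) v"
          using Aj by (auto simp: 3(3) free_pair_def grid_def)
        then show ?thesis by (rule i2[OF i(2)])
      next
        case False
        have "edge (G (i - 1) (j + 1) k) v"
          unfolding 3(3) using False i(1) Aj by (subst edge_grid) auto
        moreover have "edge (G (i - 1) j k) (G (i - 1) (j + 1) k)"
          using False i Aj by (subst D_step) auto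
        moreover have "\<not> D (i - 1) (j + 1) k"
          using j Aj by (auto simp: domain_def domain_pos_def domain_neg_def)
        ultimately show ?thesis using i by (intro i1[of "G (i - 1) (j + 1) k" "j + 1" k]) auto
      qed
    qed
  qed
qed

end

lemma levels_level:
  assumes "odd A" "s = 0 \<and> A \<ge> 1 \<or> s = 1 \<and> A \<ge> -1" "grid A b s 0 0 0 \<in> Lambda_odd"
  shows "levels (grid A b s 0 0 0) (level A b s)"
  using level_grid_0[OF assms(1,2)] level_grid_1[OF assms(1,2)] level_grid_pred[OF assms(1,2)] level_grid_mids[OF assms(1,2)]
    level_grid_connected[OF assms(1,2)] level_grid_obstructed[OF assms(1,2)] assms(3)
  by unfold_locales blast+

text \<open>Here m is 2i - 2j for even k and 2j - 2i for k = 1. As i + j = n - k, each of the three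
  inequalities amounts to 4j < 2a + 2, which for odd a is the bound 2j + 1 \<le> a of the
  domain.\<close>

lemma level_pos_iff:
  fixes a b :: int
  assumes "odd a"
  shows "v \<in> level a b 0 n \<longleftrightarrow>
    (\<exists>m\<in>M_set (int n). m > 2 * (int n - a - 1) \<and> v = (a, b) + (m, int n))
    \<or> (\<exists>m\<in>M_set (int n - 1). m < - 2 * (int n - a - 2) \<and> v = (- a - 2, b) + (m, int n - 1))
    \<or> (\<exists>m\<in>M_set (int n - 2). m > 2 * (int n - a - 3) \<and> v = (a, b) + (m, int n - 2))"
    (is "_ \<longleftrightarrow> ?P \<or> ?Q \<or> ?R")
proof
  assume "v \<in> level a b 0 n"
  then obtain i j k where v: "v = grid a b 0 i j k" "domain_pos a i j k" "i + j + k = int n"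
    unfolding level_def domain_def by (auto elim: level_setE)
  then consider "k = 0" | "k = 1" | "k = 2" by (auto simp: domain_pos_def) linarith
  then show "?P \<or> ?Q \<or> ?R"
  proof cases
    case 1
    then have "?P" using v
      by (intro bexI[of _ "2 * i - 2 * j"]) (auto simp: grid_def M_set_def domain_pos_def intro!: exI[of _ j])
    then show ?thesis ..
  next
    case 2
    then have "?Q" using v
      by (intro bexI[of _ "2 * j - 2 * i"]) (auto simp: grid_def M_set_def domain_pos_def intro!: exI[of _ i])
    then show ?thesis by blast
  next
    case 3
    then have "?R" using v
      by (intro bexI[of _ "2 * i - 2 * j"]) (auto simp: grid_def M_set_def domain_pos_def intro!: exI[of _ j])
    then show ?thesis by blast
  qed
next
  have I: "v \<in> level a b 0 n" if "v = grid a b 0 i j k" "domain_pos a i j k" "i + j + k = int n" for i j k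
    using that unfolding level_def domain_def level_set_def by auto
  assume "?P \<or> ?Q \<or> ?R"
  then show "v \<in> level a b 0 n"
  proof (elim disjE)
    assume ?P
    then obtain j where j: "0 \<le> j" "j \<le> int n" "2 * int n - 4 * j > 2 * (int n - a - 1)"
      "v = (a + (2 * int n - 4 * j), b + int n)" by (auto simp: M_set_def)
    have "2 * j \<noteq> a" using assms by auto
    with j show ?thesis by (intro I[of "int n - j" j 0]) (auto simp: grid_def domain_pos_def)
  next
    assume ?Q
    then obtain i where i: "0 \<le> i" "i \<le> int n - 1"
      "2 * (int n - 1) - 4 * i < - 2 * (int n - a - 2)"
      "v = (- a - 2 + (2 * (int n - 1) - 4 * i), b + int n - 1)" by (auto simp: M_set_def)
    have "2 * (int n - 1 - i) \<noteq> a" using assms by (metis dvd_triv_left)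
    with i show ?thesis by (intro I[of i "int n - 1 - i" 1]) (auto simp: grid_def domain_pos_def)
  next
    assume ?R
    then obtain j where j: "0 \<le> j" "j \<le> int n - 2" "2 * (int n - 2) - 4 * j > 2 * (int n - a - 3)"
      "v = (a + (2 * (int n - 2) - 4 * j), b + int n - 2)" by (auto simp: M_set_def)
    have "2 * j \<noteq> a" using assms by auto
    with j show ?thesis by (intro I[of "int n - 2 - j" j 2]) (auto simp: grid_def domain_pos_def)
  qed
qed

text \<open>With A = -a-2 the inequalities become A + 2i - 2j > -3 and A > 2j - 1; since A is odd,
  they are the bounds -1 \<le> A + 2i - 2j and 2j + 1 \<le> A of the domain.\<close>

lemma level_neg_iff:
  fixes a b :: int
  assumes "odd a"
  shows "v \<in> level (- a - 2) b 1 n \<longleftrightarrow>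
    (\<exists>m\<in>M_set (int n). m < 1 - a \<and> v = (a, b) + (m, int n))
    \<or> (\<exists>m\<in>M_set (int n - 1). m > 2 * (int n + a) \<and> v = (- a - 2, b) + (m, int n - 1))"
    (is "_ \<longleftrightarrow> ?P \<or> ?Q")
proof
  assume "v \<in> level (- a - 2) b 1 n"
  then obtain i j k where v: "v = grid (- a - 2) b 1 i j k" "domain_neg (- a - 2) i j k"
    "i + j + k = int n"
    unfolding level_def domain_def by (auto elim: level_setE)
  then consider "k = 0" | "k = 1" by (auto simp: domain_neg_def)
  then show "?P \<or> ?Q"
  proof cases
    case 1
    then have "?P" using v
      by (intro bexI[of _ "2 * j - 2 * i"]) (auto simp: grid_def M_set_def domain_neg_def intro!: exI[of _ i])
    then show ?thesis ..
  next
    case 2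
    then have "?Q" using v
      by (intro bexI[of _ "2 * i - 2 * j"]) (auto simp: grid_def M_set_def domain_neg_def intro!: exI[of _ j])
    then show ?thesis by blast
  qed
next
  have I: "v \<in> level (- a - 2) b 1 n"
    if "v = grid (- a - 2) b 1 i j k" "domain_neg (- a - 2) i j k" "i + j + k = int n" for i j k
    using that unfolding level_def domain_def level_set_def by auto
  assume "?P \<or> ?Q"
  then show "v \<in> level (- a - 2) b 1 n"
  proof (elim disjE)
    assume ?P
    then obtain i where i: "0 \<le> i" "i \<le> int n" "2 * int n - 4 * i < 1 - a"
      "v = (a + (2 * int n - 4 * i), b + int n)" by (auto simp: M_set_def)
    have "2 * (2 * i - int n) \<noteq> a" using assms by (metis dvd_triv_left)
    with i show ?thesis by (intro I[of i "int n - i" 0]) (auto simp: grid_def domain_neg_def)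
  next
    assume ?Q
    then obtain j where j: "0 \<le> j" "j \<le> int n - 1" "2 * (int n - 1) - 4 * j > 2 * (int n + a)"
      "v = (- a - 2 + (2 * (int n - 1) - 4 * j), b + int n - 1)" by (auto simp: M_set_def)
    have "2 * (- 1 - j) \<noteq> a" using assms by (metis dvd_triv_left)
    with j show ?thesis by (intro I[of "int n - 1 - j" j 1]) (auto simp: grid_def domain_neg_def)
  qed
qed

theorem theorem5p8:
  fixes n :: nat and a b :: int and \<mu> \<mu>' lam :: weight
    and R :: "nat \<Rightarrow> 'i graded_proj" and gen :: "nat \<Rightarrow> 'i \<Rightarrow> ('i \<Rightarrow>\<^sub>0 alg)"
  assumes "n \<ge> 1" and "\<mu> \<in> Lambda_odd" and "lam \<in> Lambda_odd"
    and "\<mu> = (a, b)" and "\<mu>' = (- a - 2, b)"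
    and "minimal_resolution \<mu> R gen"
  shows "(a \<ge> 1 \<longrightarrow> N_mult R n lam =
      (if (\<exists>m\<in>M_set (int n). m > 2 * (int n - a - 1) \<and> lam = \<mu> + (m, int n))
        \<or> (\<exists>m\<in>M_set (int n - 1). m < - 2 * (int n - a - 2) \<and> lam = \<mu>' + (m, int n - 1))
        \<or> (\<exists>m\<in>M_set (int n - 2). m > 2 * (int n - a - 3) \<and> lam = \<mu> + (m, int n - 2))
       then 1 else 0))
    \<and> (a \<le> - 1 \<longrightarrow> N_mult R n lam =
      (if (\<exists>m\<in>M_set (int n). m < 1 - a \<and> lam = \<mu> + (m, int n))
        \<or> (\<exists>m\<in>M_set (int n - 1). m > 2 * (int n + a) \<and> lam = \<mu>' + (m, int n - 1))
       then 1 else 0))"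
proof (intro conjI impI)
  have odd: "odd a" using assms(2,4) by (simp add: Lambda_odd_iff)
  note fold = assms(4,5)
  {
    assume "a \<ge> 1"
    then have "levels \<mu> (level a b 0)"
      using levels_level[of a 0 b] odd assms(2,4) by (simp add: grid_def)
    then interpret level_resolution \<mu> "level a b 0" R gen
      using assms(6) by (simp add: level_resolution_def level_resolution_axioms_def)
    show "N_mult R n lam =
      (if (\<exists>m\<in>M_set (int n). m > 2 * (int n - a - 1) \<and> lam = \<mu> + (m, int n))
        \<or> (\<exists>m\<in>M_set (int n - 1). m < - 2 * (int n - a - 2) \<and> lam = \<mu>' + (m, int n - 1))
        \<or> (\<exists>m\<in>M_set (int n - 2). m > 2 * (int n - a - 3) \<and> lam = \<mu> + (m, int n - 2))
       then 1 else 0)"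
      unfolding fold N_mult_eq level_pos_iff[OF odd] ..
  }
  {
    assume "a \<le> - 1"
    then have "levels \<mu> (level (- a - 2) b 1)"
      using levels_level[of "- a - 2" 1 b] odd assms(2,4) by (simp add: grid_def)
    then interpret level_resolution \<mu> "level (- a - 2) b 1" R gen
      using assms(6) by (simp add: level_resolution_def level_resolution_axioms_def)
    show "N_mult R n lam =
      (if (\<exists>m\<in>M_set (int n). m < 1 - a \<and> lam = \<mu> + (m, int n))
        \<or> (\<exists>m\<in>M_set (int n - 1). m > 2 * (int n + a) \<and> lam = \<mu>' + (m, int n - 1))
       then 1 else 0)"
      unfolding fold N_mult_eq level_neg_iff[OF odd] ..
  }
qed

end
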